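(* Let $A_{12}$ be a bounded real random variable with mean $0$ and variance $1$, let $L(\theta)=\mathbb E(e^{\theta A_{12}^2})-1$ for $\theta\in\mathbb R$, $h_L(u)=\sup_{\theta\in\mathbb R}\{\theta u-L(\theta)\}$ for $u\in\mathbb R$, and for $\mu\in\mathcal P(\mathbb R)$ let $$I_L(\mu):=\inf\Big\{\tfrac12\int_{[0,1]^2}h_L(W(x,y))\,dx\,dy: W\in\mathcal W,\ \upsilon_W=\mu\Big\},$$ where $\upsilon_W$ is the QVE measure of $W$ (and $\inf\emptyset=+\infty$). Then, for $\mu\in\mathcal P(\mathbb R)$, $I_L(\mu)=0$ if and only if $\mu$ is the semicircle law $\frac1{2\pi}\sqrt{(4-x^2)_+}\,dx$.
   Context: $\mathcal P(\mathbb R)$ is the set of Borel probability measures on $\mathbb R$. Kernels. $\mathcal W$ is the set of integrable, symmetric, non-negative Borel functions $W:[0,1]^2\to[0,+\infty)$, modulo Lebesgue-a.e. equality. The degree function of $W$ is $d_W(x)=\int_0^1W(x,y)\,dy$. $\mathcal X\subset\mathcal W$ is the subset of kernels with bounded degree function. QVE measure. Let $\mathbb H=\{z\in\mathbb C:\operatorname{Im}z>0\}$ and let $\mathcal B^+$ be the set of bounded (Borel measurable) functions $[0,1]\to\mathbb H$. For $W\in\mathcal X$ and $z\in\mathbb H$ there is a unique solution $m(z)=(m(z,x))_{x\in[0,1]}\in\mathcal B^+$ of the Quadratic Vector Equation (QVE) $-\frac1{m(z,x)}=z+\int_0^1W(x,y)m(z,y)\,dy$, $x\in[0,1]$; for each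 $x$, $z\mapsto m(z,x)$ is the Stieltjes transform $\int\frac{d\upsilon_x(t)}{t-z}$ of a probability measure $\upsilon_x$ on $\mathbb R$, with $x\mapsto\upsilon_x$ Borel measurable. One sets $\upsilon_W:=\int_0^1\upsilon_x\,dx$. For general $W\in\mathcal W$, $\upsilon_W$ is defined as the weak limit as $C\to+\infty$ of $\upsilon_{W^{(C)}}$ (which exists), where $W^{(C)}(x,y)=W(x,y)\mathbf 1_{d_W(x)\le C}\mathbf 1_{d_W(y)\le C}$. *)

theory Defs
  imports "HOL-Probability.Probability"
begin

abbreviation unit_lborel :: "real measure" where
  "unit_lborel \<equiv> restrict_space lborel {0..1}"

text \<open>
  Elements of the space \<open>\<W>\<close> are represented by functions; only their values on the unit
  square matter. The QVE measure and the integral in the rate function depend on the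
  Lebesgue-a.e. class only, so the infimum is the same over functions and over classes.
\<close>

definition kernels :: "(real \<times> real \<Rightarrow> real) set" where
  "kernels = {W. integrable (unit_lborel \<Otimes>\<^sub>M unit_lborel) W \<and>
     (\<forall>x\<in>{0..1}. \<forall>y\<in>{0..1}. W (x, y) = W (y, x) \<and> 0 \<le> W (x, y))}"

text \<open>
  The degree takes values in the extended half-line: for an integrable kernel it may be
  infinite on a null set, where the Bochner integral would return 0.
\<close>

definition degree_fun :: "(real \<times> real \<Rightarrow> real) \<Rightarrow> real \<Rightarrow> ennreal" where
  "degree_fun W x = (\<integral>\<^sup>+ y. ennreal (W (x, y)) \<partial>unit_lborel)"

definition bounded_degree_kernels :: "(real \<times> real \<Rightarrow> real) set" where
  "bounded_degree_kernels =
     {W \<in> kernels. \<exists>C::real. \<forall>x\<in>{0..1}. degree_fun W x \<le> ennreal C}"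

definition truncate_kernel :: "real \<Rightarrow> (real \<times> real \<Rightarrow> real) \<Rightarrow> real \<times> real \<Rightarrow> real" where
  "truncate_kernel C W = (\<lambda>(x, y).
     if degree_fun W x \<le> ennreal C \<and> degree_fun W y \<le> ennreal C then W (x, y) else 0)"

definition qve_solution ::
    "(real \<times> real \<Rightarrow> real) \<Rightarrow> complex \<Rightarrow> (real \<Rightarrow> complex) \<Rightarrow> bool" where
  "qve_solution W z m \<longleftrightarrow>
     m \<in> borel_measurable unit_lborel \<and> bounded (m ` {0..1}) \<and>
     (\<forall>x\<in>{0..1}. 0 < Im (m x) \<and>
        - 1 / m x = z + (\<integral>y. complex_of_real (W (x, y)) * m y \<partial>unit_lborel))"

definition stieltjes :: "real measure \<Rightarrow> complex \<Rightarrow> complex" where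
  "stieltjes \<mu> z = (\<integral>t. 1 / (complex_of_real t - z) \<partial>\<mu>)"

text \<open>
  The QVE measure is introduced through its graph: \<open>has_qve_measure W \<mu>\<close> says that
  \<open>\<upsilon>\<^sub>W\<close> exists and equals \<open>\<mu>\<close>. The monadic bind
  \<open>unit_lborel \<bind> \<upsilon>\<close> is the mixture of the measures \<open>\<upsilon> x\<close> for \<open>x\<close> uniform in the unit interval.
\<close>

definition has_qve_measure_bounded ::
    "(real \<times> real \<Rightarrow> real) \<Rightarrow> real measure \<Rightarrow> bool" where
  "has_qve_measure_bounded W \<mu> \<longleftrightarrow> W \<in> bounded_degree_kernels \<and>
     (\<exists>(m :: complex \<Rightarrow> real \<Rightarrow> complex) (\<upsilon> :: real \<Rightarrow> real measure).
        (\<forall>z. 0 < Im z \<longrightarrow> qve_solution W z (m z)) \<and>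
        \<upsilon> \<in> unit_lborel \<rightarrow>\<^sub>M prob_algebra borel \<and>
        (\<forall>x\<in>{0..1}. \<forall>z. 0 < Im z \<longrightarrow> m z x = stieltjes (\<upsilon> x) z) \<and>
        \<mu> = unit_lborel \<bind> \<upsilon>)"

text \<open>
  The weak limit as \<open>C\<close> tends to infinity along the reals is expressed by sequences. For
  kernels of bounded degree the truncation is eventually the identity, so this agrees with
  \<open>has_qve_measure_bounded\<close>.
\<close>

definition has_qve_measure :: "(real \<times> real \<Rightarrow> real) \<Rightarrow> real measure \<Rightarrow> bool" where
  "has_qve_measure W \<mu> \<longleftrightarrow> W \<in> kernels \<and> real_distribution \<mu> \<and>
     (\<exists>\<nu> :: real \<Rightarrow> real measure.
        (\<forall>C>0. has_qve_measure_bounded (truncate_kernel C W) (\<nu> C)) \<and>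
        (\<forall>c :: nat \<Rightarrow> real. filterlim c at_top sequentially \<longrightarrow>
           weak_conv_m (\<lambda>n. \<nu> (c n)) \<mu>))"

definition shifted_mgf_sq :: "'a measure \<Rightarrow> ('a \<Rightarrow> real) \<Rightarrow> real \<Rightarrow> real" where
  "shifted_mgf_sq M A \<theta> = (\<integral>\<omega>. exp (\<theta> * (A \<omega>)\<^sup>2) \<partial>M) - 1"

definition legendre :: "(real \<Rightarrow> real) \<Rightarrow> real \<Rightarrow> ereal" where
  "legendre L u = (SUP \<theta>. ereal (\<theta> * u - L \<theta>))"

text \<open>
  Conversion by \<open>e2ennreal\<close> loses nothing when \<open>L 0 = 0\<close>, since then \<open>legendre L\<close> is
  non-negative. The infimum over the empty set is \<open>\<infinity>\<close>.
\<close>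

definition rate_function :: "(real \<Rightarrow> real) \<Rightarrow> real measure \<Rightarrow> ennreal" where
  "rate_function L \<mu> = (INF W \<in> {W \<in> kernels. has_qve_measure W \<mu>}.
     (1 / 2) * (\<integral>\<^sup>+ p. e2ennreal (legendre L (W p)) \<partial>(unit_lborel \<Otimes>\<^sub>M unit_lborel)))"

definition semicircle :: "real measure" where
  "semicircle = density lborel (\<lambda>x. ennreal (sqrt (max 0 (4 - x\<^sup>2)) / (2 * pi)))"

end

theory Submission imports Defs begin

text \<open>
  Since \<open>\<theta> \<le> L \<theta> \<le> \<theta> + C \<theta>\<^sup>2\<close> near \<open>0\<close>, the Legendre transform vanishes at \<open>1\<close> and satisfies
  \<open>h u \<ge> t \<bar>u - 1\<bar> - C t\<^sup>2\<close> for all small \<open>t > 0\<close>. Hence a vanishing rate yields kernels \<open>W\<close> with QVE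
  measure \<open>\<mu>\<close> that are arbitrarily close to the constant kernel \<open>1\<close> in \<open>L\<^sup>1\<close>. For \<open>Im z\<close> large the
  QVE is a contraction, so the Stieltjes transform of the QVE measure at \<open>z\<close> is Lipschitz at the
  kernel \<open>1\<close> with respect to the \<open>L\<^sup>1\<close> distance, and \<open>\<mu>\<close> has the Stieltjes transform of the
  semicircle law on the line \<open>Im z = 2\<close>. On such a line the Stieltjes transform is the Fourier
  transform of the characteristic function damped by an exponential, so it determines \<open>\<mu>\<close>.
  Conversely the kernel \<open>1\<close> has a constant solution of the QVE: writing \<open>z = - (g + 1 / g)\<close> with
  \<open>\<bar>g\<bar> < 1\<close>, the substitution \<open>t = - 2 cos \<theta>\<close> and the series of \<open>g\<^sup>n sin ((n + 1) \<theta>)\<close> show that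
  the Stieltjes transform of the semicircle law at \<open>z\<close> is \<open>g\<close>.
\<close>

section \<open>The Stieltjes transform of the semicircle law\<close>

lemma sin_mult_sin_integral:
  fixes n :: nat
  shows "((\<lambda>\<theta>. sin \<theta> * sin (real (Suc n) * \<theta>)) has_integral (if n = 0 then pi / 2 else 0)) {0..pi}"
proof (cases "n = 0")
  case True
  have "((\<lambda>\<theta>. sin \<theta> * sin \<theta>) has_integral ((pi - sin pi * cos pi) / 2 - (0 - sin 0 * cos 0) / 2)) {0..pi}"
  proof (rule fundamental_theorem_of_calculus)
    fix x :: real
    have "sin x * sin x = 1 - cos x * cos x"
      using sin_cos_squared_add[of x] by (simp add: power2_eq_square)
    then show "((\<lambda>\<theta>. (\<theta> - sin \<theta> * cos \<theta>) / 2) has_vector_derivative sin x * sin x) (at x within {0..pi})"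
      by (auto intro!: derivative_eq_intros simp flip: has_real_derivative_iff_has_vector_derivative)
  qed auto
  with True show ?thesis by simp
next
  case False
  \<comment> \<open>Antiderivative obtained from the product-to-sum formula; it divides by
    \<open>n\<close>, hence the separate case \<open>n = 0\<close>.\<close>
  let ?F = "\<lambda>\<theta>. (sin (real n * \<theta>) / real n - sin (real (n + 2) * \<theta>) / real (n + 2)) / 2"
  have "((\<lambda>\<theta>. sin \<theta> * sin (real (Suc n) * \<theta>)) has_integral (?F pi - ?F 0)) {0..pi}"
  proof (rule fundamental_theorem_of_calculus)
    fix x :: real
    have "sin x * sin (real (Suc n) * x) = (cos (real n * x) - cos (real (n + 2) * x)) / 2"
      by (subst mult.commute, subst sin_times_sin) (simp add: algebra_simps)
    also have "\<dots> = (cos (real n * x) * real n / real n - cos (real (n + 2) * x) * real (n + 2) / real (n + 2)) / 2"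
      using False by (simp del: of_nat_add)
    finally have eq: "sin x * sin (real (Suc n) * x) = \<dots>" .
    show "(?F has_vector_derivative sin x * sin (real (Suc n) * x)) (at x within {0..pi})"
      unfolding eq has_real_derivative_iff_has_vector_derivative[symmetric]
      by (rule derivative_eq_intros refl | use False in simp)+
  qed auto
  moreover have "?F pi - ?F 0 = 0"
    using sin_npi[of n] sin_npi[of "n + 2"] by simp
  ultimately show ?thesis using False by simp
qed

text \<open>This is the generating function of the Chebyshev polynomials of the second kind at
  \<open>cos \<theta>\<close>, multiplied by \<open>sin \<theta>\<close>. By Euler's formula it is a
  difference of two geometric series with ratios \<open>g * u\<close> and \<open>g * v\<close>, and
  the denominator factors as \<open>(1 - g * u) * (1 - g * v)\<close>.\<close>

lemma sin_series_sums:
  fixes g :: complex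
  assumes g: "norm g < 1"
  shows "(\<lambda>n. g ^ n * complex_of_real (sin (real (Suc n) * \<theta>))) sums
     (complex_of_real (sin \<theta>) / (1 - 2 * g * complex_of_real (cos \<theta>) + g\<^sup>2))"
proof -
  define u where "u = cis \<theta>"
  define v where "v = cis (- \<theta>)"
  have uv: "u * v = 1" "u + v = 2 * complex_of_real (cos \<theta>)"
       "u - v = 2 * \<i> * complex_of_real (sin \<theta>)"
    by (simp_all add: u_def v_def cis_mult complex_eq_iff)
  have ug: "norm (g * u) < 1" and vg: "norm (g * v) < 1"
    using g by (simp_all add: u_def v_def norm_mult)
  have ne: "1 - g * u \<noteq> 0" "1 - g * v \<noteq> 0"
    using ug vg by auto
  have fac: "1 - 2 * g * complex_of_real (cos \<theta>) + g\<^sup>2 = (1 - g * u) * (1 - g * v)"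
  proof -
    have "(1 - g * u) * (1 - g * v) = 1 - g * (u + v) + g\<^sup>2 * (u * v)"
      by (simp add: algebra_simps power2_eq_square)
    then show ?thesis by (simp add: uv(1,2))
  qed
  have pw: "u * u ^ n - v * v ^ n = 2 * \<i> * complex_of_real (sin (real (Suc n) * \<theta>))" for n
  proof -
    have "u ^ Suc n = cis (real (Suc n) * \<theta>)" "v ^ Suc n = cis (- (real (Suc n) * \<theta>))"
      unfolding u_def v_def by (simp_all only: Complex.DeMoivre mult_minus_right)
    then have "u ^ Suc n - v ^ Suc n = 2 * \<i> * complex_of_real (sin (real (Suc n) * \<theta>))"
      by (simp only:) (simp add: complex_eq_iff)
    then show ?thesis by simp
  qed
  have "(\<lambda>n. (u * (g * u) ^ n - v * (g * v) ^ n) / (2 * \<i>)) sums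
      ((u * (1 / (1 - g * u)) - v * (1 / (1 - g * v))) / (2 * \<i>))"
    by (intro sums_divide sums_diff sums_mult geometric_sums ug vg)
  moreover have "(u * (g * u) ^ n - v * (g * v) ^ n) / (2 * \<i>) =
      g ^ n * complex_of_real (sin (real (Suc n) * \<theta>))" for n
  proof -
    have "u * (g * u) ^ n - v * (g * v) ^ n = g ^ n * (u * u ^ n - v * v ^ n)"
      by (simp add: power_mult_distrib algebra_simps)
    also have "\<dots> = (2 * \<i>) * (g ^ n * complex_of_real (sin (real (Suc n) * \<theta>)))"
      unfolding pw by (simp only: mult_ac)
    finally show ?thesis by (simp del: of_nat_Suc)
  qed
  moreover have "(u * (1 / (1 - g * u)) - v * (1 / (1 - g * v))) / (2 * \<i>) =
      complex_of_real (sin \<theta>) / ((1 - g * u) * (1 - g * v))"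
  proof -
    have "u * (1 / (1 - g * u)) - v * (1 / (1 - g * v)) = (u - v) / ((1 - g * u) * (1 - g * v))"
      using ne by (simp add: field_simps)
    then show ?thesis unfolding uv(3) by simp
  qed
  ultimately show "(\<lambda>n. g ^ n * complex_of_real (sin (real (Suc n) * \<theta>))) sums
     (complex_of_real (sin \<theta>) / (1 - 2 * g * complex_of_real (cos \<theta>) + g\<^sup>2))"
    unfolding fac by simp
qed

text \<open>Multiply the sine series by \<open>sin \<theta>\<close> and integrate term by term: by
  orthogonality only the term \<open>n = 0\<close> survives. The majorant \<open>norm g ^ n\<close>
  gives the uniform convergence that justifies the exchange.\<close>

lemma sin_sqr_quotient_integral:
  fixes g :: complex
  assumes g: "norm g < 1"
  shows "((\<lambda>\<theta>. complex_of_real ((sin \<theta>)\<^sup>2) / (1 - 2 * g * complex_of_real (cos \<theta>) + g\<^sup>2))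
     has_integral complex_of_real (pi / 2)) {0..pi}"
    (is "(?f has_integral _) _")
proof -
  define u where "u n \<theta> = g ^ n * complex_of_real (sin \<theta> * sin (real (Suc n) * \<theta>))" for n \<theta>
  have sums: "(\<lambda>n. u n \<theta>) sums ?f \<theta>" for \<theta>
    using sums_mult[OF sin_series_sums[OF g, of \<theta>], of "complex_of_real (sin \<theta>)"]
    by (simp add: u_def power2_eq_square mult_ac)
  have "uniform_limit {0..pi} (\<lambda>N \<theta>. \<Sum>n<N. u n \<theta>) (\<lambda>\<theta>. suminf (\<lambda>n. u n \<theta>)) sequentially"
  proof (rule Weierstrass_m_test)
    show "norm (u n \<theta>) \<le> norm g ^ n" for n \<theta>
    proof -
      have "norm (u n \<theta>) = norm g ^ n * (\<bar>sin \<theta>\<bar> * \<bar>sin (real (Suc n) * \<theta>)\<bar>)"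
        by (simp only: u_def norm_mult norm_power norm_of_real abs_mult)
      also have "\<dots> \<le> norm g ^ n * (1 * 1)"
        by (intro mult_left_mono mult_mono abs_sin_le_one) auto
      finally show ?thesis by simp
    qed
    show "summable (\<lambda>n. norm g ^ n)" using g by simp
  qed
  then have lim: "uniform_limit {0..pi} (\<lambda>N \<theta>. \<Sum>n<N. u n \<theta>) ?f sequentially"
    using sums_unique[OF sums] by simp
  have cont: "continuous_on {0..pi} (\<lambda>\<theta>. \<Sum>n<N. u n \<theta>)" for N
    unfolding u_def by (intro continuous_intros)
  obtain I J where I: "\<And>N. ((\<lambda>\<theta>. \<Sum>n<N. u n \<theta>) has_integral I N) {0..pi}"
    and J: "(?f has_integral J) {0..pi}" and IJ: "I \<longlonglongrightarrow> J"
    by (rule uniform_limit_integral[OF lim cont trivial_limit_sequentially]) blast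
  have "((\<lambda>\<theta>. \<Sum>n<N. u n \<theta>) has_integral (\<Sum>n<N. g ^ n * complex_of_real (if n = 0 then pi / 2 else 0))) {0..pi}" for N
    unfolding u_def
    by (intro has_integral_sum has_integral_mult_right has_integral_of_real sin_mult_sin_integral) auto
  then have IN: "I N = (\<Sum>n<N. g ^ n * complex_of_real (if n = 0 then pi / 2 else 0))" for N
    using I has_integral_unique by blast
  \<comment> \<open>The empty partial sum is \<open>0\<close>; from the first term on, every partial
    sum has integral \<open>pi / 2\<close>, hence the shift by one.\<close>
  have "I (Suc N) = complex_of_real (pi / 2)" for N
    unfolding IN by (subst sum.lessThan_Suc_shift) simp
  then have "(\<lambda>N. I (Suc N)) \<longlonglongrightarrow> complex_of_real (pi / 2)"
    by (simp only: tendsto_const)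
  with LIMSEQ_Suc[OF IJ] have "J = complex_of_real (pi / 2)"
    using LIMSEQ_unique by blast
  with J show ?thesis by simp
qed

text \<open>With \<open>t = - 2 * cos \<theta>\<close>, which increases from \<open>-2\<close> to
  \<open>2\<close>, both \<open>sqrt (4 - t\<^sup>2)\<close> and the derivative of \<open>t\<close>
  equal \<open>2 * sin \<theta>\<close>. Their product turns the semicircle density into the weight
  \<open>2 / pi * (sin \<theta>)\<^sup>2\<close>.\<close>

lemma semicircle_substitution:
  fixes f :: "real \<Rightarrow> 'b::euclidean_space"
  assumes "continuous_on {-2..2} f"
  shows "((\<lambda>\<theta>. (2 / pi * (sin \<theta>)\<^sup>2) *\<^sub>R f (- 2 * cos \<theta>)) has_integral
     integral {-2..2} (\<lambda>t. (sqrt (4 - t\<^sup>2) / (2 * pi)) *\<^sub>R f t)) {0..pi}"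
proof -
  let ?h = "\<lambda>t. (sqrt (4 - t\<^sup>2) / (2 * pi)) *\<^sub>R f t"
  have "((\<lambda>\<theta>. (2 * sin \<theta>) *\<^sub>R ?h (- 2 * cos \<theta>)) has_integral
      integral {- 2 * cos 0..- 2 * cos pi} ?h) {0..pi}"
  proof (rule has_integral_substitution[where c="-2" and d=2])
    show "(\<lambda>\<theta>. - 2 * cos \<theta>) ` {0..pi} \<subseteq> {- 2..2}"
    proof safe
      fix \<theta> :: real
      show "- 2 * cos \<theta> \<in> {- 2..2}"
        unfolding atLeastAtMost_iff using cos_le_one[of \<theta>] cos_ge_minus_one[of \<theta>] by linarith
    qed
    show "continuous_on {-2..2} ?h"
      by (intro continuous_intros assms) auto
  qed (auto intro!: derivative_eq_intros)
  then have "((\<lambda>\<theta>. (2 * sin \<theta>) *\<^sub>R ?h (- 2 * cos \<theta>)) has_integral integral {-2..2} ?h) {0..pi}"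
    by simp
  moreover have "(2 * sin \<theta>) *\<^sub>R ?h (- 2 * cos \<theta>) = (2 / pi * (sin \<theta>)\<^sup>2) *\<^sub>R f (- 2 * cos \<theta>)"
    if "\<theta> \<in> {0..pi}" for \<theta>
  proof -
    have "4 - (- 2 * cos \<theta>)\<^sup>2 = (2 * sin \<theta>)\<^sup>2"
      by (simp add: power_mult_distrib sin_squared_eq)
    then have "sqrt (4 - (- 2 * cos \<theta>)\<^sup>2) = 2 * sin \<theta>"
      using that sin_ge_zero[of \<theta>] by (intro real_sqrt_unique) auto
    then show ?thesis by (simp add: power2_eq_square)
  qed
  ultimately show ?thesis
    by (rule has_integral_eq[rotated])
qed

lemma real_distribution_semicircle: "real_distribution semicircle"
proof -
  have "((\<lambda>\<theta>. (2 / pi * (sin \<theta>)\<^sup>2)) has_integral (2 / pi * (pi / 2))) {0..pi}"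
    using has_integral_mult_right[OF sin_mult_sin_integral[of 0], of "2 / pi"]
    by (simp add: power2_eq_square)
  with semicircle_substitution[of "\<lambda>_. 1 :: real"]
  have eq: "integral {-2..2} (\<lambda>t. sqrt (4 - t\<^sup>2) / (2 * pi)) = 1"
    by (auto dest: has_integral_unique)
  have "((\<lambda>t. sqrt (4 - t\<^sup>2) / (2 * pi)) has_integral 1) {-2..2}"
    unfolding eq[symmetric]
    by (intro integrable_integral integrable_continuous_interval continuous_intros) auto
  then have "((\<lambda>t. if t \<in> {-2..2} then sqrt (4 - t\<^sup>2) / (2 * pi) else 0) has_integral 1) UNIV"
    by (simp only: has_integral_restrict_UNIV)
  moreover have "(if t \<in> {-2..2} then sqrt (4 - t\<^sup>2) / (2 * pi) else 0) = sqrt (max 0 (4 - t\<^sup>2)) / (2 * pi)"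
    for t :: real
    using abs_le_square_iff[of t 2] by (auto simp: max_def)
  ultimately have "((\<lambda>t. sqrt (max 0 (4 - t\<^sup>2)) / (2 * pi)) has_integral 1) UNIV"
    by simp
  then have "(\<integral>\<^sup>+t. ennreal (sqrt (max 0 (4 - t\<^sup>2)) / (2 * pi)) \<partial>lborel) = 1"
    by (subst nn_integral_has_integral_lborel) auto
  then show ?thesis
    by (intro real_distribution.intro real_distribution_axioms.intro prob_spaceI)
      (auto simp: semicircle_def emeasure_density)
qed

text \<open>Under the substitution, \<open>t - z\<close> becomes
  \<open>(1 - 2 * g * cos \<theta> + g\<^sup>2) / g\<close>, so that the transform reduces to
  \<open>sin_sqr_quotient_integral\<close>.\<close>

lemma stieltjes_semicircle:
  assumes g: "norm g < 1" "g \<noteq> 0" and z: "z = - (g + 1 / g)" and Im: "0 < Im z"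
  shows "stieltjes semicircle z = g"
proof -
  let ?f = "\<lambda>t. 1 / (complex_of_real t - z)"
  have ne: "complex_of_real t - z \<noteq> 0" for t
    using Im by (auto simp: complex_eq_iff)
  have cont: "continuous_on {-2..2} ?f"
    using ne by (intro continuous_intros) auto
  have meas: "?f \<in> borel_measurable borel"
    using ne by (intro borel_measurable_continuous_onI continuous_intros) auto
  have "stieltjes semicircle z =
      (\<integral>t. (sqrt (max 0 (4 - t\<^sup>2)) / (2 * pi)) *\<^sub>R ?f t \<partial>lborel)"
    unfolding stieltjes_def semicircle_def
    by (rule integral_density) (use meas in \<open>auto simp del: divide_const_simps\<close>)
  also have "\<dots> = (LBINT t:{-2..2}. (sqrt (4 - t\<^sup>2) / (2 * pi)) *\<^sub>R ?f t)"
    unfolding set_lebesgue_integral_def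
  proof (rule Bochner_Integration.integral_cong[OF refl])
    fix t :: real
    show "(sqrt (max 0 (4 - t\<^sup>2)) / (2 * pi)) *\<^sub>R ?f t =
        indicator {-2..2} t *\<^sub>R (sqrt (4 - t\<^sup>2) / (2 * pi)) *\<^sub>R ?f t"
      using abs_le_square_iff[of t 2] by (auto simp: max_def indicator_def)
  qed
  also have "\<dots> = integral {-2..2} (\<lambda>t. (sqrt (4 - t\<^sup>2) / (2 * pi)) *\<^sub>R ?f t)"
    by (intro set_borel_integral_eq_integral borel_integrable_atLeastAtMost' continuous_intros cont) auto
  also have "\<dots> = g"
  proof (rule has_integral_unique[OF semicircle_substitution[OF cont]])
    have "((\<lambda>\<theta>. (complex_of_real (2 / pi) * g) *
          (complex_of_real ((sin \<theta>)\<^sup>2) / (1 - 2 * g * complex_of_real (cos \<theta>) + g\<^sup>2)))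
        has_integral (complex_of_real (2 / pi) * g) * complex_of_real (pi / 2)) {0..pi}"
      by (intro has_integral_mult_right sin_sqr_quotient_integral g)
    moreover have "(complex_of_real (2 / pi) * g) *
          (complex_of_real ((sin \<theta>)\<^sup>2) / (1 - 2 * g * complex_of_real (cos \<theta>) + g\<^sup>2)) =
        (2 / pi * (sin \<theta>)\<^sup>2) *\<^sub>R ?f (- 2 * cos \<theta>)" for \<theta>
    proof -
      have "complex_of_real (- 2 * cos \<theta>) - z = (1 - 2 * g * complex_of_real (cos \<theta>) + g\<^sup>2) / g"
        using g(2) by (simp add: z field_simps power2_eq_square)
      then show ?thesis
        by (simp add: scaleR_conv_of_real)
    qed
    moreover have "(complex_of_real (2 / pi) * g) * complex_of_real (pi / 2) = g"
      by (simp add: field_simps)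
    ultimately show "((\<lambda>\<theta>. (2 / pi * (sin \<theta>)\<^sup>2) *\<^sub>R ?f (- 2 * cos \<theta>)) has_integral g) {0..pi}"
      by (simp only:)
  qed
  finally show ?thesis .
qed

text \<open>The equation is the QVE of the constant kernel \<open>1\<close>. Its two roots have
  product \<open>1\<close>, so one of them lies in the closed unit disc. The identity
  \<open>Imz\<close> together with \<open>0 < Im z\<close> keeps this root off the circle and puts
  it in the upper half-plane, and \<open>stieltjes_semicircle\<close> applies to it.\<close>

lemma stieltjes_semicircle_quadratic:
  assumes Im: "0 < Im z"
  shows "0 < Im (stieltjes semicircle z)"
    and "- 1 / stieltjes semicircle z = z + stieltjes semicircle z"
proof -
  obtain g where g: "g\<^sup>2 + z * g + 1 = 0" "norm g \<le> 1"
  proof -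
    define d where "d = csqrt (z\<^sup>2 - 4)"
    define a where "a = (- z + d) / 2"
    define b where "b = (- z - d) / 2"
    have d2: "d\<^sup>2 = z\<^sup>2 - 4" by (simp add: d_def)
    have ab: "a * b = 1"
    proof -
      have "a * b = (z\<^sup>2 - d\<^sup>2) / 4"
        by (simp add: a_def b_def power2_eq_square algebra_simps)
      then show ?thesis by (simp add: d2)
    qed
    have "a + b = - z"
      by (simp add: a_def b_def field_simps)
    then have zab: "z = - a - b" by (metis add_uminus_conv_diff minus_add_distrib minus_minus)
    have roots: "a\<^sup>2 + z * a + 1 = 0" "b\<^sup>2 + z * b + 1 = 0"
      using ab by (simp_all add: zab power2_eq_square algebra_simps)
    have "norm a * norm b = 1" using ab by (metis norm_mult norm_one)
    then have "norm a \<le> 1 \<or> norm b \<le> 1"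
      by (smt (verit) mult_less_cancel_left2 norm_ge_zero mult_le_cancel_left1)
    with roots that show thesis by blast
  qed
  have g0: "g \<noteq> 0" using g(1) by auto
  have z: "z = - (g + 1 / g)"
  proof -
    have "z * g = - (g\<^sup>2) - 1" using g(1) by (simp add: algebra_simps eq_neg_iff_add_eq_0)
    then have "z = (- (g\<^sup>2) - 1) / g" using g0 by (simp add: eq_divide_eq)
    also have "\<dots> = - (g + 1 / g)" using g0 by (simp add: field_simps power2_eq_square)
    finally show ?thesis .
  qed
  have "Im (1 / g) = - Im g / (norm g)\<^sup>2"
    by (simp add: Im_divide cmod_power2)
  then have Imz: "Im z = Im g * (1 / (norm g)\<^sup>2 - 1)"
    by (simp add: z algebra_simps)
  have "norm g \<noteq> 1" using Imz Im by auto
  with g have g1: "norm g < 1" by simp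
  have "1 / (norm g)\<^sup>2 - 1 > 0"
    using g0 g1 by (simp add: power_less_one_iff)
  with Imz Im have "0 < Im g"
    by (simp add: zero_less_mult_iff)
  moreover have "stieltjes semicircle z = g"
    by (rule stieltjes_semicircle[OF g1 g0 z Im])
  moreover have "- 1 / g = z + g" by (simp add: z)
  ultimately show "0 < Im (stieltjes semicircle z)"
    "- 1 / stieltjes semicircle z = z + stieltjes semicircle z"
    by simp_all
qed

section \<open>Uniqueness of Stieltjes transforms\<close>

text \<open>
  After normalisation the positive and negative parts of \<open>R\<close> are densities of probability measures
  with the same characteristic function, so that Levy's theorem applies.
\<close>

lemma Fourier_zero_imp_AE_zero_real:
  fixes R :: "real \<Rightarrow> real"
  assumes R[measurable]: "integrable lborel R"
    and zero: "\<And>x. (CLBINT s. iexp (x * s) * complex_of_real (R s)) = 0"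
  shows "AE s in lborel. R s = 0"
proof -
  define P where "P s = max 0 (R s)" for s
  define N where "N s = max 0 (- R s)" for s
  have RPN: "R s = P s - N s" for s by (simp add: P_def N_def max_def)
  have int: "integrable lborel P" "integrable lborel N"
    unfolding P_def N_def using R by auto
  have nonneg: "0 \<le> P s" "0 \<le> N s" for s by (simp_all add: P_def N_def)
  have meas[measurable]: "P \<in> borel_measurable borel" "N \<in> borel_measurable borel"
    using int by auto
  have int_iexp: "complex_integrable lborel (\<lambda>s. iexp (x * s) * complex_of_real (f s))"
    if "integrable lborel f" for x f
  proof (rule Bochner_Integration.integrable_bound[OF that])
    show "(\<lambda>s. iexp (x * s) * complex_of_real (f s)) \<in> borel_measurable lborel"
      using that by measurable
  qed (simp add: norm_mult)
  \<comment> \<open>At frequency \<open>0\<close> the hypothesis says that \<open>P\<close> and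
    \<open>N\<close> have the same mass, so one constant \<open>a\<close> normalises both.\<close>
  have "(CLBINT s. iexp (0 * s) * complex_of_real (R s)) = complex_of_real (integral\<^sup>L lborel R)"
    by simp
  then have "integral\<^sup>L lborel R = 0" unfolding zero by simp
  then have eq: "integral\<^sup>L lborel P = integral\<^sup>L lborel N"
    unfolding RPN using int by simp
  define a where "a = integral\<^sup>L lborel P"
  have "0 \<le> a" unfolding a_def by (simp add: nonneg)
  show ?thesis
  proof (cases "a = 0")
    case True
    then have "AE s in lborel. P s = 0" "AE s in lborel. N s = 0"
      using integral_nonneg_eq_0_iff_AE[OF int(1)] integral_nonneg_eq_0_iff_AE[OF int(2)]
        nonneg eq by (simp_all add: a_def)
    then show ?thesis by eventually_elim (simp add: RPN)
  next
    case False
    with \<open>0 \<le> a\<close> have a: "0 < a" by simp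
    have distr: "real_distribution (density lborel (\<lambda>s. ennreal (f s / a)))"
      if f: "integrable lborel f" "\<And>s. 0 \<le> f s" "integral\<^sup>L lborel f = a" for f
    proof -
      have "(\<integral>\<^sup>+s. ennreal (f s / a) \<partial>lborel) = ennreal (\<integral>s. f s / a \<partial>lborel)"
        using f a by (intro nn_integral_eq_integral) auto
      also have "\<dots> = 1" using f a by simp
      finally show ?thesis
        using f by (intro real_distribution.intro real_distribution_axioms.intro prob_spaceI)
          (auto simp: emeasure_density)
    qed
    have char: "char (density lborel (\<lambda>s. ennreal (f s / a))) x =
        (CLBINT s. iexp (x * s) * complex_of_real (f s)) / complex_of_real a"
      if f: "integrable lborel f" "\<And>s. 0 \<le> f s" for f x
    proof -
      have [measurable]: "f \<in> borel_measurable borel" using f(1) by auto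
      have "char (density lborel (\<lambda>s. ennreal (f s / a))) x =
          (CLBINT s. (f s / a) *\<^sub>R iexp (x * s))"
        unfolding char_def using f a
        by (subst integral_density) auto
      also have "\<dots> = (CLBINT s. (iexp (x * s) * complex_of_real (f s)) / complex_of_real a)"
        by (simp add: scaleR_conv_of_real mult.commute)
      finally show ?thesis by simp
    qed
    let ?P = "density lborel (\<lambda>s. ennreal (P s / a))"
    let ?N = "density lborel (\<lambda>s. ennreal (N s / a))"
    have "(CLBINT s. iexp (x * s) * complex_of_real (P s)) = (CLBINT s. iexp (x * s) * complex_of_real (N s))" for x
    proof -
      have "(CLBINT s. iexp (x * s) * complex_of_real (P s)) - (CLBINT s. iexp (x * s) * complex_of_real (N s))
          = (CLBINT s. iexp (x * s) * complex_of_real (R s))"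
        unfolding Bochner_Integration.integral_diff[OF int_iexp[OF int(1)] int_iexp[OF int(2)], symmetric]
        by (simp add: RPN right_diff_distrib)
      then show ?thesis unfolding zero by (simp only: right_minus_eq)
    qed
    then have "char ?P = char ?N"
      by (simp add: fun_eq_iff char int nonneg)
    then have "?P = ?N"
      by (intro Levy_uniqueness distr int nonneg eq[folded a_def, symmetric] a_def[symmetric])
    then have "AE s in lborel. ennreal (P s / a) = ennreal (N s / a)"
      by (subst (asm) sigma_finite_measure.density_unique_iff[OF sigma_finite_lborel]) auto
    then show ?thesis
      by eventually_elim (use a nonneg in \<open>simp add: RPN\<close>)
  qed
qed

text \<open>Conjugating the hypothesis at \<open>- x\<close> shows that the Fourier integrals of
  \<open>cnj (D s)\<close> vanish as well, hence those of the real and imaginary parts, and the real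
  case applies to each.\<close>

lemma Fourier_zero_imp_AE_zero:
  fixes D :: "real \<Rightarrow> complex"
  assumes D: "complex_integrable lborel D"
    and zero: "\<And>x. (CLBINT s. iexp (x * s) * D s) = 0"
  shows "AE s in lborel. D s = 0"
proof -
  have [measurable]: "D \<in> borel_measurable borel" using D by auto
  have intD: "complex_integrable lborel (\<lambda>s. iexp (x * s) * D s)" for x
    by (rule Bochner_Integration.integrable_bound[OF D]) (auto simp: norm_mult)
  have cnj_eq: "iexp (x * s) * cnj (D s) = cnj (iexp (- x * s) * D s)" for x s
    by (simp add: exp_cnj)
  have intC: "complex_integrable lborel (\<lambda>s. iexp (x * s) * cnj (D s))" for x
    unfolding cnj_eq using intD[of "- x"] by (simp only: complex_integrable_cnj)
  have cnj: "(CLBINT s. iexp (x * s) * cnj (D s)) = 0" for x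
  proof -
    have "(CLBINT s. iexp (x * s) * cnj (D s)) = cnj (CLBINT s. iexp (- x * s) * D s)"
      unfolding cnj_eq by (rule Bochner_Integration.integral_cnj)
    then show ?thesis by (simp only: zero complex_cnj_zero)
  qed
  have "AE s in lborel. Re (D s) = 0"
  proof (rule Fourier_zero_imp_AE_zero_real)
    fix x
    have "(CLBINT s. iexp (x * s) * complex_of_real (Re (D s))) =
        (CLBINT s. (iexp (x * s) * D s + iexp (x * s) * cnj (D s)) / 2)"
      by (intro Bochner_Integration.integral_cong refl)
        (simp add: complex_add_cnj flip: distrib_left)
    also have "\<dots> = ((CLBINT s. iexp (x * s) * D s) + (CLBINT s. iexp (x * s) * cnj (D s))) / 2"
      by (simp only: integral_divide_zero Bochner_Integration.integral_add[OF intD intC])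
    finally show "(CLBINT s. iexp (x * s) * complex_of_real (Re (D s))) = 0"
      unfolding zero cnj by simp
  qed (use D in auto)
  moreover have "AE s in lborel. Im (D s) = 0"
  proof (rule Fourier_zero_imp_AE_zero_real)
    fix x
    have "(CLBINT s. iexp (x * s) * complex_of_real (Im (D s))) =
        (CLBINT s. (iexp (x * s) * D s - iexp (x * s) * cnj (D s)) / (2 * \<i>))"
      by (intro Bochner_Integration.integral_cong refl)
        (subst nonzero_eq_divide_eq, simp,
          simp only: complex_diff_cnj right_diff_distrib[symmetric], simp only: of_real_mult of_real_numeral mult_ac)
    also have "\<dots> = ((CLBINT s. iexp (x * s) * D s) - (CLBINT s. iexp (x * s) * cnj (D s))) / (2 * \<i>)"
      by (simp only: integral_divide_zero Bochner_Integration.integral_diff[OF intD intC])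
    finally show "(CLBINT s. iexp (x * s) * complex_of_real (Im (D s))) = 0"
      unfolding zero cnj by simp
  qed (use D in auto)
  ultimately show ?thesis
    by eventually_elim (simp add: complex_eq_iff)
qed

section \<open>The Stieltjes transform as a Laplace transform of the characteristic function\<close>

lemma exp_half_line_integral:
  fixes w :: complex
  assumes w: "0 < Im w"
  shows "complex_integrable lborel (\<lambda>s. indicator {0<..} s *\<^sub>R exp (\<i> * complex_of_real s * w))"
    and "(CLBINT s. indicator {0<..} s *\<^sub>R exp (\<i> * complex_of_real s * w)) = \<i> / w"
proof -
  let ?f = "\<lambda>s. exp (\<i> * complex_of_real s * w)"
  have norm: "norm (?f s) = exp (- (s * Im w))" for s by simp
  have "set_integrable lborel {0<..} (\<lambda>s. exp (- (s * Im w)))"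
    by (rule integrable_I0i_exp_mscale[OF w])
  then show *: "complex_integrable lborel (\<lambda>s. indicator {0<..} s *\<^sub>R ?f s)"
    unfolding set_integrable_def
    by (rule Bochner_Integration.integrable_bound) (auto simp: indicator_def)
  have w0: "w \<noteq> 0" using w by auto
  \<comment> \<open>An antiderivative with value \<open>1 / (\<i> * w)\<close> at \<open>0\<close>;
    it tends to \<open>0\<close> at infinity because \<open>?f s\<close> has norm
    \<open>exp (- (s * Im w))\<close>.\<close>
  let ?F = "\<lambda>s. ?f s / (\<i> * w)"
  have "(CLBINT s=0..\<infinity>. ?f s) = 0 - 1 / (\<i> * w)"
  proof (rule interval_integral_FTC_integrable[where F="?F"])
    fix s
    have "((\<lambda>s. exp (\<i> * s * w) / (\<i> * w)) has_field_derivative exp (\<i> * complex_of_real s * w)) (at (complex_of_real s))"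
      using w0 by (auto intro!: derivative_eq_intros)
    then show "(?F has_vector_derivative ?f s) (at s)"
      by (rule has_vector_derivative_real_field)
    show "isCont ?f s" by (intro continuous_intros)
  next
    show "set_integrable lborel (einterval 0 \<infinity>) ?f"
      using * by (simp add: set_integrable_def zero_ereal_def)
    have "isCont ?F 0" using w0 by (intro continuous_intros) auto
    then have "(?F \<longlongrightarrow> ?F 0) (at_right 0)"
      by (simp only: isCont_def filterlim_at_split)
    then show "((?F \<circ> real_of_ereal) \<longlongrightarrow> 1 / (\<i> * w)) (at_right 0)"
      by (simp add: ereal_tendsto_simps zero_ereal_def)
    have "((\<lambda>s. exp (- (s * Im w))) \<longlongrightarrow> 0) at_top"
    proof (rule filterlim_compose[OF exp_at_bot])
      have "filterlim (\<lambda>s. s * Im w) at_top at_top"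
        by (rule filterlim_at_top_mult_tendsto_pos[OF tendsto_const w filterlim_ident])
      then show "filterlim (\<lambda>s. - (s * Im w)) at_bot at_top"
        by (simp add: filterlim_uminus_at_bot)
    qed
    then have "((\<lambda>s. norm (?f s)) \<longlongrightarrow> 0) at_top"
      by (simp only: norm)
    then have "(?f \<longlongrightarrow> 0) at_top"
      by (rule tendsto_norm_zero_cancel)
    then have "(?F \<longlongrightarrow> 0 / (\<i> * w)) at_top"
      by (rule tendsto_divide[OF _ tendsto_const]) (use w0 in simp)
    then show "((?F \<circ> real_of_ereal) \<longlongrightarrow> 0) (at_left \<infinity>)"
      by (simp add: ereal_tendsto_simps)
  qed simp
  moreover have "0 - 1 / (\<i> * w) = \<i> / w"
    using w0 by (simp add: divide_simps)
  ultimately show "(CLBINT s. indicator {0<..} s *\<^sub>R ?f s) = \<i> / w"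
    by (simp only: interval_lebesgue_integral_0_infty set_lebesgue_integral_def)
qed

text \<open>Write \<open>1 / (t - z)\<close> as \<open>\<i>\<close> times the half-line integral of
  \<open>exp (\<i> * s * (z - t))\<close> and exchange the integrals. The norm of the integrand
  depends on \<open>s\<close> only and decays exponentially, so Fubini applies, and the integral
  over \<open>t\<close> is the characteristic function at \<open>- s\<close>.\<close>

lemma (in real_distribution) stieltjes_eq_Laplace_char:
  assumes z: "0 < Im z"
  shows "complex_integrable lborel (\<lambda>s. indicator {0<..} s *\<^sub>R (exp (\<i> * complex_of_real s * z) * char M (- s)))"
    and "stieltjes M z = \<i> * (CLBINT s. indicator {0<..} s *\<^sub>R (exp (\<i> * complex_of_real s * z) * char M (- s)))"
proof -
  let ?f = "\<lambda>s t. indicator {0<..} s *\<^sub>R exp (\<i> * complex_of_real s * (z - complex_of_real t))"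
  interpret P: pair_sigma_finite lborel M ..
  have norm: "norm (?f s t) = indicator {0<..} s *\<^sub>R exp (- (s * Im z))" for s t
    by (simp add: indicator_def)
  have int: "complex_integrable (lborel \<Otimes>\<^sub>M M) (\<lambda>(s, t). ?f s t)"
  proof (rule P.Fubini_integrable)
    show "(\<lambda>(s, t). ?f s t) \<in> borel_measurable (lborel \<Otimes>\<^sub>M M)"
      by measurable
    show "integrable lborel (\<lambda>s. \<integral>t. norm (case (s, t) of (s, t) \<Rightarrow> ?f s t) \<partial>M)"
      using integrable_I0i_exp_mscale[OF z]
      by (simp only: prod.case norm) (simp add: set_integrable_def prob_space del: space_eq_univ)
    show "AE s in lborel. complex_integrable M (\<lambda>t. case (s, t) of (s, t) \<Rightarrow> ?f s t)"
    proof (rule AE_I2)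
      fix s :: real
      show "complex_integrable M (\<lambda>t. case (s, t) of (s, t) \<Rightarrow> ?f s t)"
        by (rule integrable_const_bound[where B="indicator {0<..} s *\<^sub>R exp (- (s * Im z))"])
          (simp_all only: prod.case norm, auto)
    qed
  qed
  have inner: "(CLINT t|M. ?f s t) = indicator {0<..} s *\<^sub>R (exp (\<i> * complex_of_real s * z) * char M (- s))" for s
  proof -
    have "?f s t = (indicator {0<..} s *\<^sub>R exp (\<i> * complex_of_real s * z)) * iexp (- s * t)" for t
      by (simp add: algebra_simps flip: exp_add)
    then show ?thesis
      by (simp only: char_def integral_mult_right_zero integral_scaleR_right mult_scaleR_left)
  qed
  show "complex_integrable lborel (\<lambda>s. indicator {0<..} s *\<^sub>R (exp (\<i> * complex_of_real s * z) * char M (- s)))"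
    using P.integrable_fst[OF int] by (simp only: inner)
  have "1 / (complex_of_real t - z) = \<i> * (CLBINT s. ?f s t)" for t
  proof -
    have *: "0 < Im (z - complex_of_real t)" using z by simp
    then have "z - complex_of_real t \<noteq> 0" by (metis less_irrefl zero_complex.sel(2))
    then show ?thesis
      unfolding exp_half_line_integral(2)[OF *]
      by (simp add: field_simps)
  qed
  then have "stieltjes M z = \<i> * (CLINT t|M. (CLBINT s. ?f s t))"
    by (simp add: stieltjes_def)
  also have "(CLINT t|M. (CLBINT s. ?f s t)) = (CLBINT s. (CLINT t|M. ?f s t))"
    by (rule P.Fubini_integral[OF int])
  finally show "stieltjes M z = \<i> * (CLBINT s. indicator {0<..} s *\<^sub>R (exp (\<i> * complex_of_real s * z) * char M (- s)))"
    by (simp only: inner)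
qed

text \<open>As \<open>Re z\<close> varies along the line, the difference of the two transforms is,
  up to the factor \<open>\<i>\<close>, the Fourier transform of \<open>D\<close>, the damped
  difference of the characteristic functions on the positive half-line. So \<open>D\<close> vanishes
  almost everywhere, continuity of \<open>d\<close> removes the exceptional set, and Levy's theorem
  concludes.\<close>

theorem stieltjes_uniqueness:
  assumes M: "real_distribution M" and N: "real_distribution N" and \<eta>: "0 < \<eta>"
    and eq: "\<And>z. Im z = \<eta> \<Longrightarrow> stieltjes M z = stieltjes N z"
  shows "M = N"
proof -
  interpret M: real_distribution M by fact
  interpret N: real_distribution N by fact
  define d where "d s = char M (- s) - char N (- s)" for s
  define D where "D s = indicator {0<..} s *\<^sub>R (exp (\<i> * complex_of_real s * Complex 0 \<eta>) * d s)" for s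
  have split: "indicator {0<..} s *\<^sub>R (exp (\<i> * complex_of_real s * Complex x \<eta>) * d s) = iexp (x * s) * D s" for x s
  proof -
    have "Complex x \<eta> = complex_of_real x + Complex 0 \<eta>" by (simp add: complex_eq_iff)
    then have "exp (\<i> * complex_of_real s * Complex x \<eta>) = iexp (x * s) * exp (\<i> * complex_of_real s * Complex 0 \<eta>)"
      by (simp add: algebra_simps flip: exp_add)
    then show ?thesis by (simp add: D_def)
  qed
  have IM: "0 < Im (Complex x \<eta>)" for x using \<eta> by simp
  note LM = M.stieltjes_eq_Laplace_char[OF IM] and LN = N.stieltjes_eq_Laplace_char[OF IM]
  have "complex_integrable lborel (\<lambda>s. indicator {0<..} s *\<^sub>R (exp (\<i> * complex_of_real s * Complex 0 \<eta>) * d s))"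
    using Bochner_Integration.integrable_diff[OF LM(1) LN(1), of 0 0]
    by (simp add: d_def right_diff_distrib scaleR_diff_right)
  then have D: "complex_integrable lborel D"
    by (simp add: D_def[abs_def])
  have "(CLBINT s. iexp (x * s) * D s) = 0" for x
  proof -
    have "\<i> * (CLBINT s. indicator {0<..} s *\<^sub>R (exp (\<i> * complex_of_real s * Complex x \<eta>) * d s)) =
        stieltjes M (Complex x \<eta>) - stieltjes N (Complex x \<eta>)"
      unfolding LM(2) LN(2) right_diff_distrib[symmetric]
        Bochner_Integration.integral_diff[OF LM(1) LN(1), symmetric]
      by (simp add: d_def right_diff_distrib scaleR_diff_right)
    also have "\<dots> = 0" using eq[of "Complex x \<eta>"] by simp
    finally show ?thesis by (simp only: split) simp
  qed
  from Fourier_zero_imp_AE_zero[OF D this]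
  have AE: "AE s in lborel. D s = 0" .
  have cont: "continuous_on UNIV d"
  proof (rule continuous_at_imp_continuous_on, rule ballI)
    fix s
    have "isCont (\<lambda>s. char L (- s)) s" if "real_distribution L" for L
      by (rule isCont_o2[OF _ real_distribution.isCont_char[OF that]]) (intro continuous_intros)
    from this[OF M] this[OF N] show "isCont d s"
      unfolding d_def[abs_def] by (rule continuous_diff)
  qed
  have pos: "d s = 0" if "0 < s" for s
  proof (rule ccontr)
    assume "d s \<noteq> 0"
    let ?U = "{0<..} \<inter> d -` (- {0})"
    have "open ?U"
      by (intro open_Int open_vimage cont) auto
    moreover have "s \<in> ?U" using that \<open>d s \<noteq> 0\<close> by simp
    moreover have "?U \<in> null_sets lborel"
      using AE \<open>open ?U\<close> by (subst AE_iff_null_sets) (auto simp: D_def elim: eventually_mono)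
    ultimately show False
      using open_not_negligible[of ?U] negligible_iff_null_sets[of ?U] null_sets_completionI by blast
  qed
  have "char M t = char N t" for t
  proof -
    consider "t < 0" | "t = 0" | "t > 0" by linarith
    then show ?thesis
    proof cases
      case 1
      then show ?thesis using pos[of "- t"] by (simp add: d_def)
    next
      case 2
      then show ?thesis by (simp add: M.char_zero N.char_zero)
    next
      \<comment> \<open>\<open>pos\<close> reaches the characteristic functions at negative
        arguments only; conjugation symmetry gives the positive ones.\<close>
      case 3
      have cnj: "char L (- t) = cnj (char L t)" for L
        unfolding char_def by (subst Bochner_Integration.integral_cnj[symmetric]) (simp add: exp_cnj)
      have "char M (- t) = char N (- t)" using pos[OF 3] by (simp add: d_def)
      then show ?thesis by (simp add: cnj)
    qed
  qed
  then show ?thesis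
    by (intro Levy_uniqueness[OF M N]) (simp add: fun_eq_iff)
qed

section \<open>Stability of the quadratic vector equation\<close>

lemma prob_space_unit_lborel: "prob_space unit_lborel"
  by (rule prob_spaceI) (simp add: emeasure_restrict_space space_restrict_space)

lemma pair_prob_space_unit: "pair_prob_space unit_lborel unit_lborel"
  unfolding pair_prob_space_def pair_sigma_finite_def
  by (simp add: prob_space_unit_lborel prob_space_imp_sigma_finite)

lemma space_unit_lborel: "space unit_lborel = {0..1}"
  by (simp add: space_restrict_space)

lemma measure_unit_lborel: "measure unit_lborel {0..1} = 1"
  using prob_space.prob_space[OF prob_space_unit_lborel] by (simp only: space_unit_lborel)

lemma kernel_measurable: "W \<in> kernels \<Longrightarrow> W \<in> borel_measurable (unit_lborel \<Otimes>\<^sub>M unit_lborel)"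
  by (simp add: kernels_def borel_measurable_integrable)

lemma kernel_nonneg: "W \<in> kernels \<Longrightarrow> x \<in> {0..1} \<Longrightarrow> y \<in> {0..1} \<Longrightarrow> 0 \<le> W (x, y)"
  by (simp add: kernels_def)

lemma degree_fun_measurable:
  assumes "W \<in> kernels"
  shows "degree_fun W \<in> borel_measurable unit_lborel"
proof -
  interpret U: prob_space unit_lborel by (rule prob_space_unit_lborel)
  note kernel_measurable[OF assms, measurable]
  show ?thesis unfolding degree_fun_def[abs_def] by measurable
qed

lemma kernel_section_integrable:
  assumes W: "W \<in> bounded_degree_kernels" and x: "x \<in> {0..1}"
  shows "integrable unit_lborel (\<lambda>y. W (x, y))"
proof (rule integrableI_nonneg)
  have K: "W \<in> kernels" using W by (simp add: bounded_degree_kernels_def)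
  have "x \<in> space unit_lborel" using x by (simp add: space_unit_lborel)
  then show "(\<lambda>y. W (x, y)) \<in> borel_measurable unit_lborel"
    by (rule measurable_Pair2[OF kernel_measurable[OF K]])
  show "AE y in unit_lborel. 0 \<le> W (x, y)"
    by (rule AE_I2) (use kernel_nonneg[OF K x] in \<open>simp add: space_unit_lborel\<close>)
  obtain C where "degree_fun W x \<le> ennreal C"
    using W x unfolding bounded_degree_kernels_def by blast
  then show "(\<integral>\<^sup>+ y. ennreal (W (x, y)) \<partial>unit_lborel) < \<infinity>"
    by (simp add: degree_fun_def le_less_trans)
qed

text \<open>\<open>1 / norm m\<close> is the norm of \<open>z + s\<close>, which is at least
  \<open>Im (z + s)\<close> and hence at least \<open>Im z\<close>.\<close>

lemma norm_le_inverse_Im: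
  fixes m s z :: complex
  assumes eq: "- 1 / m = z + s" and s: "0 \<le> Im s" and z: "0 < Im z"
  shows "norm m \<le> 1 / Im z"
proof -
  have "Im z \<le> norm (z + s)"
    using abs_Im_le_cmod[of "z + s"] s by simp
  also have "\<dots> = 1 / norm m"
    by (simp add: norm_divide flip: eq)
  finally have *: "Im z \<le> 1 / norm m" .
  \<comment> \<open>For \<open>m = 0\<close> the right-hand side of \<open>*\<close> would be
    \<open>1 / 0 = 0\<close>, against \<open>0 < Im z\<close>.\<close>
  then have "0 < norm m" using z by (cases "m = 0") auto
  with * z show ?thesis by (simp add: field_simps)
qed

text \<open>Since the kernel is non-negative and \<open>m\<close> takes values in the upper
  half-plane, the integral term has non-negative imaginary part; the resulting bound does not depend
  on the kernel.\<close>

lemma qve_solution_norm_le: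
  assumes W: "W \<in> bounded_degree_kernels" and qve: "qve_solution W z m"
    and z: "0 < Im z" and x: "x \<in> {0..1}"
  shows "integrable unit_lborel (\<lambda>y. complex_of_real (W (x, y)) * m y)"
    and "norm (m x) \<le> 1 / Im z"
proof -
  have K: "W \<in> kernels" using W by (simp add: bounded_degree_kernels_def)
  have m[measurable]: "m \<in> borel_measurable unit_lborel" and bdd: "bounded (m ` {0..1})"
    and Im: "\<And>x. x \<in> {0..1} \<Longrightarrow> 0 < Im (m x)"
    and eq: "- 1 / m x = z + (\<integral>y. complex_of_real (W (x, y)) * m y \<partial>unit_lborel)"
    using qve x by (auto simp: qve_solution_def)
  note Wx = kernel_section_integrable[OF W x]
  note borel_measurable_integrable[OF Wx, measurable]
  obtain B where B: "\<And>y. y \<in> {0..1} \<Longrightarrow> norm (m y) \<le> B"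
    using bdd unfolding bounded_iff by blast
  show int: "integrable unit_lborel (\<lambda>y. complex_of_real (W (x, y)) * m y)"
  proof (rule Bochner_Integration.integrable_bound)
    show "integrable unit_lborel (\<lambda>y. W (x, y) * B)" using Wx by simp
    show "AE y in unit_lborel. norm (complex_of_real (W (x, y)) * m y) \<le> norm (W (x, y) * B)"
    proof (rule AE_I2)
      fix y assume "y \<in> space unit_lborel"
      then have "norm (m y) \<le> \<bar>B\<bar>" using B[of y] by (simp add: space_unit_lborel)
      then show "norm (complex_of_real (W (x, y)) * m y) \<le> norm (W (x, y) * B)"
        by (simp add: norm_mult abs_mult mult_left_mono)
    qed
  qed measurable
  have "0 \<le> (\<integral>y. Im (complex_of_real (W (x, y)) * m y) \<partial>unit_lborel)"
  proof (rule Bochner_Integration.integral_nonneg)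
    fix y assume "y \<in> space unit_lborel"
    then have y: "y \<in> {0..1}" by (simp add: space_unit_lborel)
    show "0 \<le> Im (complex_of_real (W (x, y)) * m y)"
      using Im[OF y] kernel_nonneg[OF K x y] by simp
  qed
  then have "0 \<le> Im (\<integral>y. complex_of_real (W (x, y)) * m y \<partial>unit_lborel)"
    by (simp only: integral_Im[OF int])
  from norm_le_inverse_Im[OF eq this z] show "norm (m x) \<le> 1 / Im z" .
qed

text \<open>
  On \<open>Im z \<ge> 2\<close> both \<open>m\<close> and \<open>g\<close> are bounded by \<open>1/2\<close>, so subtracting the two equations
  gives a contraction with error term \<open>W - 1\<close>.
\<close>

lemma qve_stability:
  assumes W: "W \<in> bounded_degree_kernels" and qve: "qve_solution W z m"
    and z: "2 \<le> Im z" and g: "- 1 / g = z + g" "0 < Im g"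
  shows "integrable unit_lborel m"
    and "norm ((\<integral>x. m x \<partial>unit_lborel) - g) \<le> (\<integral>p. \<bar>W p - 1\<bar> \<partial>(unit_lborel \<Otimes>\<^sub>M unit_lborel))"
proof -
  let ?U = unit_lborel
  interpret U: prob_space ?U by (rule prob_space_unit_lborel)
  interpret P: pair_prob_space ?U ?U by (rule pair_prob_space_unit)
  have K: "W \<in> kernels" using W by (simp add: bounded_degree_kernels_def)
  then have intW: "integrable (?U \<Otimes>\<^sub>M ?U) (\<lambda>p. \<bar>W p - 1\<bar>)"
    by (simp add: kernels_def)
  have m[measurable]: "m \<in> borel_measurable ?U"
    using qve by (simp add: qve_solution_def)
  have z0: "0 < Im z" using z by simp
  have half: "1 / Im z \<le> 1 / 2" using z by (simp add: field_simps)
  have mle: "norm (m x) \<le> 1 / 2" if "x \<in> {0..1}" for x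
    using qve_solution_norm_le(2)[OF W qve z0 that] half by linarith
  have gle: "norm g \<le> 1 / 2"
    using norm_le_inverse_Im[OF g(1) _ z0] g(2) half by linarith
  have g0: "g \<noteq> 0" using g(2) by auto
  show intm: "integrable ?U m"
    by (rule U.integrable_const_bound[where B="1/2"])
      (intro AE_I2 mle, simp_all add: space_unit_lborel)
  have intE: "integrable ?U (\<lambda>y. norm (m y - g))" using intm by auto
  define E where "E = (\<integral>y. norm (m y - g) \<partial>?U)"
  define d where "d x = (\<integral>y. \<bar>W (x, y) - 1\<bar> \<partial>?U)" for x
  have int_d: "integrable ?U d"
    unfolding d_def by (rule P.integrable_fst'[OF intW])
  have pointwise: "norm (m x - g) \<le> (d x / 2 + E) / 4" if x: "x \<in> {0..1}" for x
  proof -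
    note int = qve_solution_norm_le(1)[OF W qve z0 x]
    have intWx: "integrable ?U (\<lambda>y. \<bar>W (x, y) - 1\<bar>)"
      using kernel_section_integrable[OF W x] by auto
    have "0 < Im (m x)"
      using qve x unfolding qve_solution_def by blast
    then have mx0: "m x \<noteq> 0" by auto
    have eq: "- 1 / m x = z + (\<integral>y. complex_of_real (W (x, y)) * m y \<partial>?U)"
      using qve x by (simp add: qve_solution_def)
    \<comment> \<open>Comparing reciprocals cancels \<open>z\<close> between the two equations, and
      the prefactor \<open>m x * g\<close> has norm at most \<open>1 / 4\<close>.\<close>
    have "m x - g = m x * g * (- 1 / m x - (- 1 / g))"
      using mx0 g0 by (simp add: field_simps)
    also have "\<dots> = m x * g * ((\<integral>y. complex_of_real (W (x, y)) * m y \<partial>?U) - g)"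
      unfolding eq g(1) by simp
    also have "(\<integral>y. complex_of_real (W (x, y)) * m y \<partial>?U) - g =
        (\<integral>y. complex_of_real (W (x, y)) * m y - g \<partial>?U)"
      using int by (simp add: measure_unit_lborel)
    finally have meq: "m x - g = m x * g * (\<integral>y. complex_of_real (W (x, y)) * m y - g \<partial>?U)" .
    have "norm (\<integral>y. complex_of_real (W (x, y)) * m y - g \<partial>?U) \<le>
        (\<integral>y. norm (complex_of_real (W (x, y)) * m y - g) \<partial>?U)"
      by (rule integral_norm_bound)
    also have "\<dots> \<le> (\<integral>y. \<bar>W (x, y) - 1\<bar> / 2 + norm (m y - g) \<partial>?U)"
    proof (rule Bochner_Integration.integral_mono)
      fix y assume "y \<in> space ?U"
      then have y: "norm (m y) \<le> 1 / 2" using mle by (simp add: space_unit_lborel)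
      have "complex_of_real (W (x, y)) * m y - g = complex_of_real (W (x, y) - 1) * m y + (m y - g)"
        by (simp add: algebra_simps)
      also have "norm \<dots> \<le> norm (complex_of_real (W (x, y) - 1) * m y) + norm (m y - g)"
        by (rule norm_triangle_ineq)
      also have "norm (complex_of_real (W (x, y) - 1) * m y) \<le> \<bar>W (x, y) - 1\<bar> * (1 / 2)"
        unfolding norm_mult norm_of_real by (intro mult_left_mono y) simp
      finally show "norm (complex_of_real (W (x, y)) * m y - g) \<le> \<bar>W (x, y) - 1\<bar> / 2 + norm (m y - g)"
        by simp
    qed (use int intWx intE in auto)
    also have "\<dots> = d x / 2 + E"
      using intWx intE by (simp add: d_def E_def)
    finally have bound: "norm (\<integral>y. complex_of_real (W (x, y)) * m y - g \<partial>?U) \<le> d x / 2 + E" .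
    have "norm (m x * g) \<le> 1 / 2 * (1 / 2)"
      unfolding norm_mult by (intro mult_mono mle x gle) auto
    then have "norm (m x - g) \<le> 1 / 4 * (d x / 2 + E)"
      unfolding meq norm_mult[of "m x * g"]
      by (intro mult_mono bound) auto
    then show ?thesis by simp
  qed
  \<comment> \<open>With \<open>D\<close> for the \<open>L1\<close> distance of \<open>W\<close>
    from \<open>1\<close>, averaging over \<open>x\<close> gives
    \<open>E \<le> (D / 2 + E) / 4\<close>, that is \<open>E \<le> D / 6\<close>.\<close>
  have "E \<le> (\<integral>x. (d x / 2 + E) / 4 \<partial>?U)"
    unfolding E_def
    by (rule Bochner_Integration.integral_mono[OF intE])
      (use int_d pointwise in \<open>auto simp: space_unit_lborel E_def\<close>)
  also have "\<dots> = ((\<integral>x. d x \<partial>?U) / 2 + E) / 4"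
    using int_d by (simp add: measure_unit_lborel)
  also have "(\<integral>x. d x \<partial>?U) = (\<integral>p. \<bar>W p - 1\<bar> \<partial>(?U \<Otimes>\<^sub>M ?U))"
    unfolding d_def by (rule P.integral_fst'[OF intW])
  finally have "E \<le> (\<integral>p. \<bar>W p - 1\<bar> \<partial>(?U \<Otimes>\<^sub>M ?U)) / 6" by simp
  moreover have "0 \<le> (\<integral>p. \<bar>W p - 1\<bar> \<partial>(?U \<Otimes>\<^sub>M ?U))" by simp
  moreover have "norm ((\<integral>x. m x \<partial>?U) - g) \<le> E"
  proof -
    have "(\<integral>x. m x \<partial>?U) - g = (\<integral>x. m x - g \<partial>?U)"
      using intm by (simp add: measure_unit_lborel)
    then show ?thesis unfolding E_def by (simp only: integral_norm_bound)
  qed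
  ultimately show "norm ((\<integral>x. m x \<partial>?U) - g) \<le> (\<integral>p. \<bar>W p - 1\<bar> \<partial>(?U \<Otimes>\<^sub>M ?U))"
    by linarith
qed

section \<open>Stieltjes transforms of mixtures\<close>

lemma Stieltjes_kernel_bound:
  assumes "0 < Im z"
  shows "norm (1 / (complex_of_real t - z)) \<le> 1 / Im z"
proof -
  have "Im z \<le> norm (complex_of_real t - z)"
    using abs_Im_le_cmod[of "complex_of_real t - z"] assms by simp
  then show ?thesis
    using assms by (simp add: norm_divide frac_le)
qed

lemma isCont_Stieltjes_kernel:
  assumes "0 < Im z"
  shows "isCont (\<lambda>t. 1 / (complex_of_real t - z)) t"
proof -
  have "complex_of_real t - z \<noteq> 0" using assms by (auto simp: complex_eq_iff)
  then show ?thesis by (intro continuous_intros) auto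
qed

lemma Stieltjes_kernel_measurable:
  assumes "0 < Im z"
  shows "(\<lambda>t. 1 / (complex_of_real t - z)) \<in> borel_measurable borel"
  using isCont_Stieltjes_kernel[OF assms]
  by (intro borel_measurable_continuous_onI continuous_at_imp_continuous_on) auto

lemma real_distribution_bind:
  assumes M: "prob_space M" and N: "N \<in> M \<rightarrow>\<^sub>M prob_algebra borel"
  shows "real_distribution (M \<bind> N)"
proof -
  interpret prob_space M by fact
  have "prob_space (M \<bind> N)"
    by (rule prob_space_bind[where S=borel])
      (use N in \<open>auto intro!: AE_I2 measurable_prob_algebraD dest: measurable_space simp: space_prob_algebra\<close>)
  moreover have "sets (M \<bind> N) = sets borel"
    by (rule sets_bind) (use N not_empty in \<open>auto dest: measurable_space simp: space_prob_algebra\<close>)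
  ultimately show ?thesis
    by (simp add: real_distribution_def real_distribution_axioms_def)
qed

text \<open>The integrand is bounded by \<open>1 / Im z\<close>, so integration against the mixture
  may be iterated. This is done for real and imaginary parts separately; \<open>part\<close> covers
  both as real functions dominated by the norm.\<close>

lemma stieltjes_bind:
  assumes M: "prob_space M" and N: "N \<in> M \<rightarrow>\<^sub>M prob_algebra borel" and z: "0 < Im z"
    and int: "integrable M (\<lambda>x. stieltjes (N x) z)"
  shows "stieltjes (M \<bind> N) z = (\<integral>x. stieltjes (N x) z \<partial>M)"
proof -
  interpret M: prob_space M by fact
  interpret B: real_distribution "M \<bind> N" by (rule real_distribution_bind[OF M N])
  let ?f = "\<lambda>t. 1 / (complex_of_real t - z)"
  note meas[measurable] = Stieltjes_kernel_measurable[OF z]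
  note bound = Stieltjes_kernel_bound[OF z]
  have kernel: "real_distribution (N x)" if "x \<in> space M" for x
    using measurable_space[OF N that]
    by (simp add: space_prob_algebra real_distribution_def real_distribution_axioms_def)
  have intf: "integrable L ?f" if "real_distribution L" for L
  proof -
    interpret L: real_distribution L by fact
    show ?thesis
      by (rule L.integrable_const_bound[where B="1 / Im z"]) (auto intro!: AE_I2 bound)
  qed
  have part: "(\<integral>t. h (?f t) \<partial>(M \<bind> N)) = (\<integral>x. (\<integral>t. h (?f t) \<partial>N x) \<partial>M)"
    if h[measurable]: "h \<in> borel_measurable borel" and le: "\<And>w. \<bar>h w\<bar> \<le> norm w" for h :: "complex \<Rightarrow> real"
  proof (rule integral_bind[where K=borel and B="1 / Im z" and B'=1])
    show "\<bar>h (?f t)\<bar> \<le> 1 / Im z" for t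
      using le[of "?f t"] bound[of t] by linarith
    show "AE x in M. emeasure (N x) (space (N x)) \<le> ennreal 1"
      by (rule AE_I2) (simp add: prob_space.emeasure_space_1 real_distribution.axioms(1)[OF kernel])
    show "finite_measure M" by (rule M.finite_measure_axioms)
    show "N \<in> M \<rightarrow>\<^sub>M subprob_algebra borel" by (rule measurable_prob_algebraD[OF N])
  qed measurable
  show ?thesis
  proof (rule complex_eqI)
    have "Re (stieltjes (M \<bind> N) z) = (\<integral>t. Re (?f t) \<partial>(M \<bind> N))"
      unfolding stieltjes_def by (rule integral_Re[symmetric]) (rule intf[OF B.real_distribution_axioms])
    also have "\<dots> = (\<integral>x. (\<integral>t. Re (?f t) \<partial>N x) \<partial>M)"
      by (rule part) (auto simp: abs_Re_le_cmod)
    also have "\<dots> = (\<integral>x. Re (stieltjes (N x) z) \<partial>M)"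
      unfolding stieltjes_def
      by (intro Bochner_Integration.integral_cong refl integral_Re intf kernel)
    also have "\<dots> = Re (\<integral>x. stieltjes (N x) z \<partial>M)"
      by (rule integral_Re[OF int])
    finally show "Re (stieltjes (M \<bind> N) z) = Re (\<integral>x. stieltjes (N x) z \<partial>M)" .
    have "Im (stieltjes (M \<bind> N) z) = (\<integral>t. Im (?f t) \<partial>(M \<bind> N))"
      unfolding stieltjes_def by (rule integral_Im[symmetric]) (rule intf[OF B.real_distribution_axioms])
    also have "\<dots> = (\<integral>x. (\<integral>t. Im (?f t) \<partial>N x) \<partial>M)"
      by (rule part) (auto simp: abs_Im_le_cmod)
    also have "\<dots> = (\<integral>x. Im (stieltjes (N x) z) \<partial>M)"
      unfolding stieltjes_def
      by (intro Bochner_Integration.integral_cong refl integral_Im intf kernel)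
    also have "\<dots> = Im (\<integral>x. stieltjes (N x) z \<partial>M)"
      by (rule integral_Im[OF int])
    finally show "Im (stieltjes (M \<bind> N) z) = Im (\<integral>x. stieltjes (N x) z \<partial>M)" .
  qed
qed

text \<open>The transform of the mixture is the average of \<open>m z\<close>, so the stability
  bound applies with the semicircle transform as \<open>g\<close>.\<close>

lemma has_qve_measure_bounded_stieltjes_close:
  assumes qve: "has_qve_measure_bounded W \<nu>" and z: "2 \<le> Im z"
  shows "real_distribution \<nu>"
    and "norm (stieltjes \<nu> z - stieltjes semicircle z) \<le>
      (\<integral>p. \<bar>W p - 1\<bar> \<partial>(unit_lborel \<Otimes>\<^sub>M unit_lborel))"
proof -
  have z0: "0 < Im z" using z by simp
  obtain m \<upsilon> where W: "W \<in> bounded_degree_kernels"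
    and sol: "\<And>z. 0 < Im z \<Longrightarrow> qve_solution W z (m z)"
    and \<upsilon>: "\<upsilon> \<in> unit_lborel \<rightarrow>\<^sub>M prob_algebra borel"
    and m: "\<And>x z. x \<in> {0..1} \<Longrightarrow> 0 < Im z \<Longrightarrow> m z x = stieltjes (\<upsilon> x) z"
    and \<nu>: "\<nu> = unit_lborel \<bind> \<upsilon>"
    using qve unfolding has_qve_measure_bounded_def by blast
  show "real_distribution \<nu>"
    unfolding \<nu> by (rule real_distribution_bind[OF prob_space_unit_lborel \<upsilon>])
  note stab = qve_stability[OF W sol[OF z0] z
      stieltjes_semicircle_quadratic(2)[OF z0] stieltjes_semicircle_quadratic(1)[OF z0]]
  have "integrable unit_lborel (m z) \<longleftrightarrow> integrable unit_lborel (\<lambda>x. stieltjes (\<upsilon> x) z)"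
    by (rule Bochner_Integration.integrable_cong) (auto simp: space_unit_lborel m[OF _ z0])
  then have "integrable unit_lborel (\<lambda>x. stieltjes (\<upsilon> x) z)"
    using stab(1) by simp
  from stieltjes_bind[OF prob_space_unit_lborel \<upsilon> z0 this]
  have "stieltjes \<nu> z = (\<integral>x. stieltjes (\<upsilon> x) z \<partial>unit_lborel)" by (simp only: \<nu>)
  also have "\<dots> = (\<integral>x. m z x \<partial>unit_lborel)"
    by (rule Bochner_Integration.integral_cong) (auto simp: space_unit_lborel m[OF _ z0])
  finally show "norm (stieltjes \<nu> z - stieltjes semicircle z) \<le>
      (\<integral>p. \<bar>W p - 1\<bar> \<partial>(unit_lborel \<Otimes>\<^sub>M unit_lborel))"
    using stab(2) by simp
qed

section \<open>Removing the degree bound by truncation\<close>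

lemma AE_degree_fun_finite:
  assumes W: "W \<in> kernels"
  shows "AE p in unit_lborel \<Otimes>\<^sub>M unit_lborel. degree_fun W (fst p) \<noteq> \<infinity> \<and> degree_fun W (snd p) \<noteq> \<infinity>"
proof -
  let ?U = unit_lborel
  interpret U: prob_space ?U by (rule prob_space_unit_lborel)
  interpret P: pair_prob_space ?U ?U by (rule pair_prob_space_unit)
  note [measurable] = degree_fun_measurable[OF W] kernel_measurable[OF W]
  \<comment> \<open>By Tonelli the degrees integrate to the total mass of \<open>W\<close>, which is
    finite.\<close>
  have "(\<integral>\<^sup>+x. degree_fun W x \<partial>?U) = (\<integral>\<^sup>+p. ennreal (W p) \<partial>(?U \<Otimes>\<^sub>M ?U))"
    unfolding degree_fun_def by (rule U.nn_integral_fst) measurable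
  also have "\<dots> \<le> (\<integral>\<^sup>+p. ennreal (norm (W p)) \<partial>(?U \<Otimes>\<^sub>M ?U))"
    by (intro nn_integral_mono ennreal_leI) simp
  also have "\<dots> < \<infinity>"
    using W by (simp add: kernels_def integrable_iff_bounded)
  finally have ae: "AE x in ?U. degree_fun W x \<noteq> \<infinity>"
    by (intro nn_integral_noteq_infinite) auto
  show ?thesis
  proof (rule P.AE_pair_measure)
    show "AE x in ?U. AE y in ?U. degree_fun W (fst (x, y)) \<noteq> \<infinity> \<and> degree_fun W (snd (x, y)) \<noteq> \<infinity>"
      using ae
    proof eventually_elim
      case (elim x)
      show ?case using ae by eventually_elim (use elim in simp)
    qed
  qed measurable
qed

text \<open>Where both degrees are finite, the truncation is eventually inactive;
  \<open>\<bar>W p\<bar> + 1\<close> dominates.\<close>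

lemma truncate_kernel_L1_limit:
  assumes W: "W \<in> kernels" and T: "\<And>n. truncate_kernel (c n) W \<in> kernels"
    and c: "filterlim c at_top sequentially"
  shows "(\<lambda>n. \<integral>p. \<bar>truncate_kernel (c n) W p - 1\<bar> \<partial>(unit_lborel \<Otimes>\<^sub>M unit_lborel)) \<longlonglongrightarrow>
    (\<integral>p. \<bar>W p - 1\<bar> \<partial>(unit_lborel \<Otimes>\<^sub>M unit_lborel))"
proof (rule integral_dominated_convergence)
  let ?P = "unit_lborel \<Otimes>\<^sub>M unit_lborel :: (real \<times> real) measure"
  interpret P: pair_prob_space unit_lborel unit_lborel by (rule pair_prob_space_unit)
  note [measurable] = kernel_measurable[OF W] kernel_measurable[OF T]
  show "(\<lambda>p. \<bar>W p - 1\<bar>) \<in> borel_measurable ?P" by measurable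
  show "(\<lambda>p. \<bar>truncate_kernel (c n) W p - 1\<bar>) \<in> borel_measurable ?P" for n by measurable
  show "integrable ?P (\<lambda>p. \<bar>W p\<bar> + 1)"
    using W by (auto simp: kernels_def)
  show "AE p in ?P. norm \<bar>truncate_kernel (c n) W p - 1\<bar> \<le> \<bar>W p\<bar> + 1" for n
    by (rule AE_I2) (auto simp: truncate_kernel_def split: prod.split)
  show "AE p in ?P. (\<lambda>n. \<bar>truncate_kernel (c n) W p - 1\<bar>) \<longlonglongrightarrow> \<bar>W p - 1\<bar>"
    using AE_degree_fun_finite[OF W]
  proof eventually_elim
    case (elim p)
    obtain x y where p: "p = (x, y)" by (cases p)
    obtain a b where ab: "degree_fun W x = ennreal a" "degree_fun W y = ennreal b"
      using elim by (metis ennreal_cases fst_conv infinity_ennreal_def p snd_conv)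
    have "eventually (\<lambda>n. max a b \<le> c n) sequentially"
      using c unfolding filterlim_at_top by blast
    then have "eventually (\<lambda>n. \<bar>truncate_kernel (c n) W p - 1\<bar> = \<bar>W p - 1\<bar>) sequentially"
      by eventually_elim (auto simp: truncate_kernel_def p ab ennreal_leI)
    then show ?case by (rule tendsto_eventually)
  qed
qed

text \<open>The estimate for bounded degree survives the limit: weak convergence carries over to the
  transforms because their integrand is bounded and continuous, and the \<open>L1\<close> distances
  of the truncations converge.\<close>

lemma has_qve_measure_stieltjes_close:
  assumes qve: "has_qve_measure W \<mu>" and z: "2 \<le> Im z"
  shows "norm (stieltjes \<mu> z - stieltjes semicircle z) \<le>
      (\<integral>p. \<bar>W p - 1\<bar> \<partial>(unit_lborel \<Otimes>\<^sub>M unit_lborel))"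
proof -
  have z0: "0 < Im z" using z by simp
  \<comment> \<open>The shift makes every level positive, as \<open>has_qve_measure\<close> speaks
    of truncations at \<open>C > 0\<close> only.\<close>
  define c where "c n = real (Suc n)" for n
  have c: "filterlim c at_top sequentially"
    unfolding c_def by (rule filterlim_compose[OF filterlim_real_sequentially filterlim_Suc])
  have cpos: "0 < c n" for n by (simp add: c_def)
  obtain \<nu> where W: "W \<in> kernels" and \<mu>: "real_distribution \<mu>"
    and \<nu>: "\<And>C. C > 0 \<Longrightarrow> has_qve_measure_bounded (truncate_kernel C W) (\<nu> C)"
    and lim: "weak_conv_m (\<lambda>n. \<nu> (c n)) \<mu>"
    using qve c unfolding has_qve_measure_def by blast
  note close = has_qve_measure_bounded_stieltjes_close[OF \<nu>[OF cpos] z]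
  have "(\<lambda>n. stieltjes (\<nu> (c n)) z) \<longlonglongrightarrow> stieltjes \<mu> z"
    unfolding stieltjes_def
    by (rule weak_conv_imp_integral_bdd_continuous_conv[OF close(1) \<mu> lim])
      (rule isCont_Stieltjes_kernel[OF z0], rule Stieltjes_kernel_bound[OF z0])
  then have "(\<lambda>n. norm (stieltjes (\<nu> (c n)) z - stieltjes semicircle z)) \<longlonglongrightarrow>
      norm (stieltjes \<mu> z - stieltjes semicircle z)"
    by (intro tendsto_intros)
  moreover have "truncate_kernel (c n) W \<in> kernels" for n
    using \<nu>[OF cpos[of n]] by (simp add: has_qve_measure_bounded_def bounded_degree_kernels_def)
  note truncate_kernel_L1_limit[OF W this c]
  ultimately show ?thesis
    by (rule LIMSEQ_le) (use close(2) in blast)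
qed

text \<open>A solution that is constant in \<open>x\<close> reduces the QVE to a scalar equation,
  and the mixture of a constant family is \<open>L\<close> itself. Both \<open>a = 1\<close> and
  \<open>a = 0\<close> occur as truncations of the kernel \<open>1\<close>.\<close>

lemma has_qve_measure_bounded_const:
  assumes a: "0 \<le> a" and L: "real_distribution L"
    and eq: "\<And>z. 0 < Im z \<Longrightarrow> 0 < Im (stieltjes L z) \<and>
      - 1 / stieltjes L z = z + complex_of_real a * stieltjes L z"
  shows "has_qve_measure_bounded (\<lambda>_. a) L"
proof -
  interpret U: prob_space unit_lborel by (rule prob_space_unit_lborel)
  interpret P: pair_prob_space unit_lborel unit_lborel by (rule pair_prob_space_unit)
  interpret L: real_distribution L by fact
  have "(\<lambda>_. a) \<in> kernels"
    using a by (simp add: kernels_def)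
  moreover have "degree_fun (\<lambda>_. a) x = ennreal a" for x
    using U.emeasure_space_1 by (simp add: degree_fun_def)
  ultimately have W: "(\<lambda>_. a) \<in> bounded_degree_kernels"
    by (auto simp: bounded_degree_kernels_def)
  have "qve_solution (\<lambda>_. a) z (\<lambda>_. stieltjes L z)" if "0 < Im z" for z
    using eq[OF that] U.prob_space by (auto simp: qve_solution_def image_constant_conv)
  moreover have "(\<lambda>_. L) \<in> unit_lborel \<rightarrow>\<^sub>M prob_algebra borel"
    by (rule measurable_const) (simp add: space_prob_algebra L.prob_space_axioms)
  moreover have "L = unit_lborel \<bind> (\<lambda>_. L)"
    by (rule bind_const'[symmetric]) (simp_all add: U.prob_space_axioms L.subprob_space_axioms)
  ultimately show ?thesis
    unfolding has_qve_measure_bounded_def using W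
    by (intro conjI exI[of _ "\<lambda>z _. stieltjes L z"] exI[of _ "\<lambda>_. L"]) auto
qed

lemma has_qve_measure_semicircle: "has_qve_measure (\<lambda>_. 1) semicircle"
proof -
  interpret U: prob_space unit_lborel by (rule prob_space_unit_lborel)
  interpret P: pair_prob_space unit_lborel unit_lborel by (rule pair_prob_space_unit)
  \<comment> \<open>All degrees equal \<open>1\<close>, so truncation keeps the kernel for
    \<open>1 \<le> C\<close> and annihilates it otherwise. The zero kernel has the solution
    \<open>- 1 / z\<close>, the transform of the point mass at \<open>0\<close>.\<close>
  let ?\<nu> = "\<lambda>C::real. if 1 \<le> C then semicircle else return borel 0"
  have deg: "degree_fun (\<lambda>_. 1) x = 1" for x
    using U.emeasure_space_1 by (simp add: degree_fun_def)
  have trunc: "truncate_kernel C (\<lambda>_. 1) = (\<lambda>_. if 1 \<le> C then 1 else 0)" for C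
    by (auto simp: truncate_kernel_def deg fun_eq_iff)
  have zero: "has_qve_measure_bounded (\<lambda>_. 0) (return borel 0)"
  proof (rule has_qve_measure_bounded_const)
    show "real_distribution (return borel 0)"
      by (simp add: real_distribution_def real_distribution_axioms_def prob_space_return)
    fix z :: complex
    assume z: "0 < Im z"
    have "stieltjes (return borel 0) z = - 1 / z"
      unfolding stieltjes_def
      by (subst integral_return) (simp_all add: Stieltjes_kernel_measurable[OF z])
    moreover have "0 < (cmod z)\<^sup>2" using z by auto
    ultimately show "0 < Im (stieltjes (return borel 0) z) \<and>
        - 1 / stieltjes (return borel 0) z = z + complex_of_real 0 * stieltjes (return borel 0) z"
      using z by (simp add: Im_divide cmod_power2)
  qed simp
  have one: "has_qve_measure_bounded (\<lambda>_. 1) semicircle"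
    by (rule has_qve_measure_bounded_const)
      (use stieltjes_semicircle_quadratic in \<open>auto simp: real_distribution_semicircle\<close>)
  have "weak_conv_m (\<lambda>n. ?\<nu> (c n)) semicircle" if "filterlim c at_top sequentially" for c
    unfolding weak_conv_m_def weak_conv_def
  proof (intro allI impI)
    fix x
    have "eventually (\<lambda>n. 1 \<le> c n) sequentially"
      using that by (simp add: filterlim_at_top)
    then have "eventually (\<lambda>n. cdf (?\<nu> (c n)) x = cdf semicircle x) sequentially"
      by eventually_elim simp
    then show "(\<lambda>n. cdf (?\<nu> (c n)) x) \<longlonglongrightarrow> cdf semicircle x"
      by (rule tendsto_eventually)
  qed
  moreover have "(\<lambda>_. 1) \<in> kernels" by (simp add: kernels_def)
  moreover have "has_qve_measure_bounded (truncate_kernel C (\<lambda>_. 1)) (?\<nu> C)" for C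
    using zero one by (simp add: trunc)
  ultimately show ?thesis
    unfolding has_qve_measure_def
    by (intro conjI exI[of _ ?\<nu>] real_distribution_semicircle) auto
qed

section \<open>The Legendre transform and the rate function\<close>

text \<open>After multiplication by \<open>1 - x > 0\<close>, the left side is at most
  \<open>1\<close> because \<open>1 - x \<le> exp (- x)\<close>, while the right side is
  \<open>1 + x\<^sup>2 * (1 - 2 * x)\<close>, which is at least \<open>1\<close>.\<close>

lemma exp_le_quadratic:
  fixes x :: real
  assumes "\<bar>x\<bar> \<le> 1 / 2"
  shows "exp x \<le> 1 + x + 2 * x\<^sup>2"
proof -
  have "1 - x \<le> exp (- x)" using exp_ge_add_one_self[of "- x"] by simp
  then have "exp x * (1 - x) \<le> exp x * exp (- x)" by simp
  also have "\<dots> = 1" by (simp flip: exp_add)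
  also have "1 \<le> (1 + x + 2 * x\<^sup>2) * (1 - x)"
  proof -
    have "(1 + x + 2 * x\<^sup>2) * (1 - x) = 1 + x\<^sup>2 * (1 - 2 * x)"
      by (simp add: algebra_simps power2_eq_square)
    then show ?thesis using assms by (simp add: abs_le_iff)
  qed
  finally have "exp x * (1 - x) \<le> (1 + x + 2 * x\<^sup>2) * (1 - x)" .
  moreover have "0 < 1 - x" using assms by linarith
  ultimately show ?thesis by (rule mult_right_le_imp_le)
qed

text \<open>Take expectations in \<open>1 + y \<le> exp y \<le> 1 + y + 2 * y\<^sup>2\<close> at
  \<open>y = \<theta> * (A \<omega>)\<^sup>2\<close>, whose mean is \<open>\<theta>\<close>. The
  smallness condition admits the upper bound, and the quadratic term is controlled by
  \<open>K ^ 4\<close>.\<close>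

lemma (in prob_space) shifted_mgf_sq_bounds:
  assumes A[measurable]: "A \<in> borel_measurable M" and bdd: "AE \<omega> in M. \<bar>A \<omega>\<bar> \<le> K"
    and one: "(\<integral>\<omega>. (A \<omega>)\<^sup>2 \<partial>M) = 1"
  shows "\<theta> \<le> shifted_mgf_sq M A \<theta>"
    and "\<bar>\<theta>\<bar> * K\<^sup>2 \<le> 1 / 2 \<Longrightarrow> shifted_mgf_sq M A \<theta> \<le> \<theta> + 2 * K ^ 4 * \<theta>\<^sup>2"
proof -
  have sq: "AE \<omega> in M. (A \<omega>)\<^sup>2 \<le> K\<^sup>2"
    using bdd by eventually_elim (metis abs_ge_zero power2_abs power_mono)
  have sq4: "AE \<omega> in M. (A \<omega>) ^ 4 \<le> K ^ 4"
    using bdd by eventually_elim (metis abs_ge_zero power_even_abs_numeral even_numeral power_mono)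
  have int2: "integrable M (\<lambda>\<omega>. (A \<omega>)\<^sup>2)"
    by (rule integrable_const_bound[where B="K\<^sup>2"]) (use sq in auto)
  have int_exp: "integrable M (\<lambda>\<omega>. exp (\<theta> * (A \<omega>)\<^sup>2))"
  proof (rule integrable_const_bound[where B="exp (\<bar>\<theta>\<bar> * K\<^sup>2)"])
    show "AE \<omega> in M. norm (exp (\<theta> * (A \<omega>)\<^sup>2)) \<le> exp (\<bar>\<theta>\<bar> * K\<^sup>2)"
      using sq
    proof eventually_elim
      case (elim \<omega>)
      have "\<theta> * (A \<omega>)\<^sup>2 \<le> \<bar>\<theta>\<bar> * K\<^sup>2"
        by (intro mult_mono elim) auto
      then show ?case by simp
    qed
  qed measurable
  have "\<theta> + 1 = (\<integral>\<omega>. \<theta> * (A \<omega>)\<^sup>2 + 1 \<partial>M)"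
    using int2 by (simp add: one prob_space)
  also have "\<dots> \<le> (\<integral>\<omega>. exp (\<theta> * (A \<omega>)\<^sup>2) \<partial>M)"
    by (rule integral_mono) (use int2 int_exp exp_ge_add_one_self in \<open>auto simp: add.commute\<close>)
  finally show "\<theta> \<le> shifted_mgf_sq M A \<theta>"
    by (simp add: shifted_mgf_sq_def)
  assume small: "\<bar>\<theta>\<bar> * K\<^sup>2 \<le> 1 / 2"
  have "(\<integral>\<omega>. exp (\<theta> * (A \<omega>)\<^sup>2) \<partial>M) \<le> (\<integral>\<omega>. 1 + \<theta> * (A \<omega>)\<^sup>2 + 2 * K ^ 4 * \<theta>\<^sup>2 \<partial>M)"
  proof (rule integral_mono_AE[OF int_exp])
    show "integrable M (\<lambda>\<omega>. 1 + \<theta> * (A \<omega>)\<^sup>2 + 2 * K ^ 4 * \<theta>\<^sup>2)" using int2 by simp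
    show "AE \<omega> in M. exp (\<theta> * (A \<omega>)\<^sup>2) \<le> 1 + \<theta> * (A \<omega>)\<^sup>2 + 2 * K ^ 4 * \<theta>\<^sup>2"
      using sq sq4
    proof eventually_elim
      case (elim \<omega>)
      have "\<bar>\<theta> * (A \<omega>)\<^sup>2\<bar> \<le> \<bar>\<theta>\<bar> * K\<^sup>2"
        unfolding abs_mult by (intro mult_mono) (use elim in auto)
      with small have "exp (\<theta> * (A \<omega>)\<^sup>2) \<le> 1 + \<theta> * (A \<omega>)\<^sup>2 + 2 * (\<theta> * (A \<omega>)\<^sup>2)\<^sup>2"
        by (intro exp_le_quadratic) simp
      also have "(\<theta> * (A \<omega>)\<^sup>2)\<^sup>2 = \<theta>\<^sup>2 * (A \<omega>) ^ 4"
        by (simp add: power_mult_distrib)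
      also have "\<dots> \<le> \<theta>\<^sup>2 * K ^ 4"
        by (intro mult_left_mono elim) simp
      finally show ?case by (simp add: mult_ac)
    qed
  qed
  also have "\<dots> = 1 + \<theta> + 2 * K ^ 4 * \<theta>\<^sup>2"
    using int2 by (simp add: one prob_space)
  finally show "shifted_mgf_sq M A \<theta> \<le> \<theta> + 2 * K ^ 4 * \<theta>\<^sup>2"
    by (simp add: shifted_mgf_sq_def)
qed

section \<open>Growth of the Legendre transform away from its zero at \<open>1\<close>, and the rate
  function\<close>

lemma legendre_1_le:
  assumes "\<And>\<theta>. \<theta> \<le> L \<theta>"
  shows "legendre L 1 \<le> 0"
  unfolding legendre_def using assms by (intro SUP_least) simp

text \<open>Test the supremum at \<open>t\<close> or \<open>- t\<close> according to the sign of
  \<open>u - 1\<close>: this gives linear growth on both sides of \<open>1\<close> at the cost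
  \<open>c * t\<^sup>2\<close>.\<close>

lemma legendre_ge:
  assumes L: "\<And>\<theta>. \<bar>\<theta>\<bar> \<le> r \<Longrightarrow> L \<theta> \<le> \<theta> + c * \<theta>\<^sup>2" and t: "0 \<le> t" "t \<le> r"
  shows "ereal (t * \<bar>u - 1\<bar> - c * t\<^sup>2) \<le> legendre L u"
proof -
  define \<theta> where "\<theta> = (if u \<ge> 1 then t else - t)"
  have "\<bar>\<theta>\<bar> \<le> r" "\<theta>\<^sup>2 = t\<^sup>2" "\<theta> * (u - 1) = t * \<bar>u - 1\<bar>"
    using t by (auto simp: \<theta>_def algebra_simps)
  with L[of \<theta>] have "t * \<bar>u - 1\<bar> - c * t\<^sup>2 \<le> \<theta> * u - L \<theta>"
    by (simp add: algebra_simps)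
  also have "ereal (\<theta> * u - L \<theta>) \<le> legendre L u"
    unfolding legendre_def by (rule SUP_upper) simp
  finally show ?thesis by simp
qed

lemma L1_distance_le_legendre_integral:
  assumes W: "W \<in> kernels"
    and L: "\<And>\<theta>. \<bar>\<theta>\<bar> \<le> r \<Longrightarrow> L \<theta> \<le> \<theta> + c * \<theta>\<^sup>2" and t: "0 \<le> t" "t \<le> r"
    and le: "(\<integral>\<^sup>+ p. e2ennreal (legendre L (W p)) \<partial>(unit_lborel \<Otimes>\<^sub>M unit_lborel)) \<le> ennreal \<delta>"
    and \<delta>: "0 \<le> \<delta>"
  shows "t * (\<integral>p. \<bar>W p - 1\<bar> \<partial>(unit_lborel \<Otimes>\<^sub>M unit_lborel)) \<le> \<delta> + c * t\<^sup>2"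
proof -
  let ?P = "unit_lborel \<Otimes>\<^sub>M unit_lborel :: (real \<times> real) measure"
  interpret P: pair_prob_space unit_lborel unit_lborel by (rule pair_prob_space_unit)
  let ?f = "\<lambda>p. t * \<bar>W p - 1\<bar> - c * t\<^sup>2"
  have int: "integrable ?P (\<lambda>p. \<bar>W p - 1\<bar>)"
    using W by (simp add: kernels_def)
  then have intf: "integrable ?P ?f" by simp
  \<comment> \<open>The lower bound \<open>?f\<close> is negative where \<open>W\<close> is close to
    \<open>1\<close> and \<open>c * t\<^sup>2 > 0\<close>. The conversion to \<open>ennreal\<close>
    keeps its positive part, whose integral dominates that of \<open>?f\<close>.\<close>
  have "ennreal (\<integral>p. max 0 (?f p) \<partial>?P) = (\<integral>\<^sup>+p. ennreal (max 0 (?f p)) \<partial>?P)"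
    using intf by (intro nn_integral_eq_integral[symmetric]) auto
  also have "\<dots> \<le> (\<integral>\<^sup>+ p. e2ennreal (legendre L (W p)) \<partial>?P)"
  proof (rule nn_integral_mono)
    fix p
    have "ennreal (?f p) = e2ennreal (ereal (?f p))" by (simp add: e2ennreal_ereal)
    also have "\<dots> \<le> e2ennreal (legendre L (W p))"
      by (intro e2ennreal_mono legendre_ge[OF L t])
    finally show "ennreal (max 0 (?f p)) \<le> e2ennreal (legendre L (W p))"
      by (simp add: max_def ennreal_neg)
  qed
  also note le
  finally have "(\<integral>p. max 0 (?f p) \<partial>?P) \<le> \<delta>" using \<delta> by simp
  moreover have "(\<integral>p. ?f p \<partial>?P) \<le> (\<integral>p. max 0 (?f p) \<partial>?P)"
    using intf by (intro integral_mono) auto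
  moreover have "(\<integral>p. ?f p \<partial>?P) = t * (\<integral>p. \<bar>W p - 1\<bar> \<partial>?P) - c * t\<^sup>2"
    using int by (simp add: P.prob_space)
  ultimately show ?thesis by simp
qed

lemma rate_function_semicircle:
  assumes "\<And>\<theta>. \<theta> \<le> L \<theta>"
  shows "rate_function L semicircle = 0"
proof -
  have "(\<lambda>_. 1) \<in> {W \<in> kernels. has_qve_measure W semicircle}"
    using has_qve_measure_semicircle by (simp add: has_qve_measure_def)
  then have "rate_function L semicircle \<le>
      (1 / 2) * (\<integral>\<^sup>+ p. e2ennreal (legendre L 1) \<partial>(unit_lborel \<Otimes>\<^sub>M unit_lborel))"
    unfolding rate_function_def by (rule INF_lower2) simp
  \<comment> \<open>An upper bound by \<open>0\<close> suffices, since \<open>e2ennreal\<close>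
    sends non-positive values to \<open>0\<close>.\<close>
  also have "e2ennreal (legendre L 1) = 0"
    using legendre_1_le[OF assms] by (rule e2ennreal_neg)
  finally show ?thesis by simp
qed

text \<open>The distance of the transforms of \<open>\<mu>\<close> and of the semicircle law does
  not depend on the competitor \<open>W\<close>, yet it is bounded by the \<open>L1\<close> distance
  of \<open>W\<close> from \<open>1\<close>. A vanishing rate makes that distance arbitrarily
  small.\<close>

lemma rate_function_eq_0_imp_semicircle:
  assumes L: "\<And>\<theta>. \<bar>\<theta>\<bar> \<le> r \<Longrightarrow> L \<theta> \<le> \<theta> + c * \<theta>\<^sup>2" and r: "0 < r" and c: "0 \<le> c"
    and \<mu>: "real_distribution \<mu>" and zero: "rate_function L \<mu> = 0"
  shows "\<mu> = semicircle"
proof (rule stieltjes_uniqueness[OF \<mu> real_distribution_semicircle, of 2])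
  fix z assume z: "Im z = 2"
  let ?P = "unit_lborel \<Otimes>\<^sub>M unit_lborel :: (real \<times> real) measure"
  have "norm (stieltjes \<mu> z - stieltjes semicircle z) \<le> 0"
  proof (rule field_le_epsilon)
    fix \<epsilon> :: real
    assume \<epsilon>: "0 < \<epsilon>"
    \<comment> \<open>The quadratic cost, divided by \<open>t\<close>, leaves an error
      \<open>c * t\<close> that has to stay below \<open>\<epsilon> / 2\<close>;
      \<open>c + 1\<close> keeps the denominator positive, and \<open>r\<close> limits the range on
      which \<open>L\<close> is controlled.\<close>
    define t where "t = min r (\<epsilon> / (2 * (c + 1)))"
    have t: "0 < t" "t \<le> r" using r c \<epsilon> by (simp_all add: t_def)
    have "c * t \<le> (c + 1) * t" using t by (simp add: algebra_simps)
    also have "\<dots> \<le> (c + 1) * (\<epsilon> / (2 * (c + 1)))"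
      using c by (intro mult_left_mono) (simp_all add: t_def)
    also have "\<dots> = \<epsilon> / 2" using c by (simp add: field_simps)
    finally have ct: "c * t \<le> \<epsilon> / 2" .
    \<comment> \<open>The threshold is proportional to \<open>t\<close>: removing the factor
      \<open>1 / 2\<close> and dividing by \<open>t\<close> leaves the other
      \<open>\<epsilon> / 2\<close>.\<close>
    have "rate_function L \<mu> < ennreal (t * \<epsilon> / 4)"
      using zero t \<epsilon> by simp
    then obtain W where W: "W \<in> kernels" "has_qve_measure W \<mu>"
      and "(1 / 2) * (\<integral>\<^sup>+ p. e2ennreal (legendre L (W p)) \<partial>?P) < ennreal (t * \<epsilon> / 4)"
      unfolding rate_function_def INF_less_iff by blast
    then have "2 * ((1 / 2) * (\<integral>\<^sup>+ p. e2ennreal (legendre L (W p)) \<partial>?P)) \<le> 2 * ennreal (t * \<epsilon> / 4)"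
      by (intro mult_left_mono) auto
    also have "2 * ennreal (t * \<epsilon> / 4) = ennreal (t * \<epsilon> / 2)"
      using t \<epsilon> by (simp flip: ennreal_numeral ennreal_mult)
    also have "2 * ((1 / 2) * (\<integral>\<^sup>+ p. e2ennreal (legendre L (W p)) \<partial>?P)) =
        (\<integral>\<^sup>+ p. e2ennreal (legendre L (W p)) \<partial>?P)"
      by (simp add: mult.assoc[symmetric] ennreal_times_divide)
    finally have "t * (\<integral>p. \<bar>W p - 1\<bar> \<partial>?P) \<le> t * \<epsilon> / 2 + c * t\<^sup>2"
      using t \<epsilon> by (intro L1_distance_le_legendre_integral[OF W(1) L _ t(2)]) auto
    also have "\<dots> = t * (\<epsilon> / 2 + c * t)"
      by (simp add: power2_eq_square algebra_simps)
    finally have "(\<integral>p. \<bar>W p - 1\<bar> \<partial>?P) \<le> \<epsilon> / 2 + c * t"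
      using t(1) by simp
    with ct have "(\<integral>p. \<bar>W p - 1\<bar> \<partial>?P) \<le> \<epsilon>" by simp
    with has_qve_measure_stieltjes_close[OF W(2), of z] z
    show "norm (stieltjes \<mu> z - stieltjes semicircle z) \<le> 0 + \<epsilon>" by simp
  qed
  then show "stieltjes \<mu> z = stieltjes semicircle z" by simp
qed simp

theorem lemma1p6:
  fixes M :: "'a measure" and A :: "'a \<Rightarrow> real" and \<mu> :: "real measure"
  assumes "prob_space M"
    and "A \<in> borel_measurable M"
    and "\<exists>K::real. AE \<omega> in M. \<bar>A \<omega>\<bar> \<le> K"
    and "(\<integral>\<omega>. A \<omega> \<partial>M) = 0"
    and "(\<integral>\<omega>. (A \<omega> - (\<integral>\<omega>'. A \<omega>' \<partial>M))\<^sup>2 \<partial>M) = 1"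
    and "real_distribution \<mu>"
  shows "rate_function (shifted_mgf_sq M A) \<mu> = 0 \<longleftrightarrow> \<mu> = semicircle"
proof -
  interpret prob_space M by fact
  obtain K where K: "AE \<omega> in M. \<bar>A \<omega>\<bar> \<le> K" using assms(3) by blast
  \<comment> \<open>The mean is zero, so the variance is the second moment.\<close>
  have one: "(\<integral>\<omega>. (A \<omega>)\<^sup>2 \<partial>M) = 1" using assms(4,5) by simp
  note bounds = shifted_mgf_sq_bounds[OF assms(2) K one]
  \<comment> \<open>Ensures \<open>\<bar>\<theta>\<bar> * K\<^sup>2 \<le> 1 / 2\<close> for
    \<open>\<bar>\<theta>\<bar> \<le> r\<close>; adding \<open>1\<close> to \<open>K\<^sup>2\<close>
    covers \<open>K = 0\<close>.\<close>
  define r where "r = 1 / (2 * (K\<^sup>2 + 1))"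
  have pos: "0 < K\<^sup>2 + 1" by (simp add: add_nonneg_pos)
  have "shifted_mgf_sq M A \<theta> \<le> \<theta> + 2 * K ^ 4 * \<theta>\<^sup>2" if "\<bar>\<theta>\<bar> \<le> r" for \<theta>
  proof (rule bounds(2))
    have "\<bar>\<theta>\<bar> * K\<^sup>2 \<le> r * (K\<^sup>2 + 1)"
      by (intro mult_mono that) (use pos in \<open>auto simp: r_def\<close>)
    also have "\<dots> = 1 / 2" using pos by (simp add: r_def)
    finally show "\<bar>\<theta>\<bar> * K\<^sup>2 \<le> 1 / 2" .
  qed
  moreover have "0 < r" using pos by (simp add: r_def)
  ultimately have "rate_function (shifted_mgf_sq M A) \<mu> = 0 \<Longrightarrow> \<mu> = semicircle"
    by (rule rate_function_eq_0_imp_semicircle[OF _ _ _ assms(6)]) simp_all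
  then show ?thesis
    using rate_function_semicircle[of "shifted_mgf_sq M A", OF bounds(1)] by blast
qed

end
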